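(* There is an absolute constant $C>0$ such that for every $u\in L^2(\mathbb{R})$, every integer $N\ge 0$ and every scaling factor $\beta>0$, \[ \bigl\|u-\widehat{\Pi}_N^\beta u\bigr\| \le C\Bigl( \bigl\|u\cdot \mathbb{I}_{\{|x|>a\sqrt{N}/\beta\}}\bigr\| + \bigl\|\mathcal{F}[u](k)\cdot \mathbb{I}_{\{|k|>b\sqrt{N}\beta\}}\bigr\| + \|u\|\,e^{-cN}\Bigr), \] where $a=b=\frac{1}{2\sqrt 2}$ and $c=\frac{1}{16}$.
   Context: $\|\cdot\|$ is the $L^2(\mathbb{R})$ norm and $(\cdot,\cdot)$ the $L^2(\mathbb{R})$ inner product. $\mathbb{I}_A$ denotes the indicator function of a set $A$ (equal to $1$ on $A$, $0$ elsewhere). The Fourier transform is $\mathcal{F}[u](k)=\frac{1}{\sqrt{2\pi}}\int_{-\infty}^{\infty}u(x)e^{-ikx}\,dx$ (extended to $L^2$ as usual). For $\beta>0$, $\widehat{P}_N^\beta=\{e^{-\beta^2x^2/2}\psi(x):\ \psi \text{ a polynomial of degree}\le N\}$, and $\widehat{\Pi}_N^\beta:L^2(\mathbb{R})\to\widehat{P}_N^\beta$ is the orthogonal projection, i.e. $(u-\widehat{\Pi}_N^\beta u, v_N)=0$ for all $v_N\in\widehat{P}_N^\beta$. *)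

theory Defs
  imports "HOL-Analysis.Analysis" "HOL-Computational_Algebra.Polynomial"
begin

definition sq_int :: "(real \<Rightarrow> complex) \<Rightarrow> bool" where
  "sq_int u \<longleftrightarrow> u \<in> borel_measurable lborel \<and> integrable lborel (\<lambda>x. (cmod (u x))^2)"

definition L2_norm :: "(real \<Rightarrow> complex) \<Rightarrow> real" where
  "L2_norm u = sqrt (LINT x|lborel. (cmod (u x))^2)"

definition L2_inner :: "(real \<Rightarrow> complex) \<Rightarrow> (real \<Rightarrow> complex) \<Rightarrow> complex" where
  "L2_inner u v = (LINT x|lborel. u x * cnj (v x))"

definition hermite_space :: "real \<Rightarrow> nat \<Rightarrow> (real \<Rightarrow> complex) set" where
  "hermite_space \<beta> N = {v. \<exists>\<psi> :: complex poly. degree \<psi> \<le> N \<and>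
      v = (\<lambda>x. complex_of_real (exp (- (\<beta>^2 * x^2) / 2)) * poly \<psi> (complex_of_real x))}"

definition is_proj :: "(real \<Rightarrow> complex) \<Rightarrow> real \<Rightarrow> nat \<Rightarrow> (real \<Rightarrow> complex) \<Rightarrow> bool" where
  "is_proj u \<beta> N w \<longleftrightarrow> w \<in> hermite_space \<beta> N \<and>
      (\<forall>v \<in> hermite_space \<beta> N. L2_inner (\<lambda>x. u x - w x) v = 0)"

definition fourier_trunc :: "(real \<Rightarrow> complex) \<Rightarrow> real \<Rightarrow> real \<Rightarrow> complex" where
  "fourier_trunc u R k = complex_of_real (1 / sqrt (2 * pi)) *
      (LINT x|lborel. indicator {-R..R} x * u x * exp (- \<i> * complex_of_real (k * x)))"

definition is_L2_fourier :: "(real \<Rightarrow> complex) \<Rightarrow> (real \<Rightarrow> complex) \<Rightarrow> bool" where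
  "is_L2_fourier u g \<longleftrightarrow> sq_int g \<and>
      ((\<lambda>R. L2_norm (\<lambda>k. g k - fourier_trunc u R k)) \<longlongrightarrow> 0) at_top"

end

(* In the phase plane of the short-time Fourier transform with window exp(-b^2 x^2/2), cut out the box
   |q| <= 2T, |p| <= 2S, where T and S are the two truncation radii of the statement.  The residual r = u - w
   is orthogonal to the Hermite space, so its transform is a Gaussian times an entire function with a zero of
   order N + 1 at the origin, and the maximum principle makes it exponentially small on the box.  Off the box,
   the transform of u is controlled by the spatial tail of u, the frequency tail of its Fourier transform and
   Gaussian tails.  The transform is an isometry up to a constant, so the squared norm of r is a multiple of the
   phase-plane inner product of the transforms of r and u; splitting that integral along the box and applying
   Cauchy-Schwarz to both parts gives the estimate. *)

theory Submission
  imports Defs "HOL-Probability.Probability" "HOL-Complex_Analysis.Complex_Analysis"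
begin

section \<open>Square-integrable functions\<close>

text \<open>The pairing is taken with \<open>u\<close>, and not with the residual itself, because
  nothing is known about the tails of \<open>w\<close>: off the box only the transform of
  \<open>u\<close> is controlled, on the box only that of \<open>r\<close>. Each half of the
  integral needs its other factor merely through the total norm, and one factor of the norm of
  \<open>r\<close> cancels at the end. Doubling the radii leaves a gap of width T (or S) between the
  part of \<open>u\<close> within the radius and the outside of the box. Since b^2 T^2 = S^2 / b^2 =
  N/8, leakage of the Gaussian window across this gap costs exp(-N/8) in energy, that is c = 1/16 in
  norm. On the box b^2 q^2 + p^2 / b^2 is at most N, and there the maximum principle bounds the
  energy density of \<open>r\<close> by a multiple of exp(N/2) / 2^(N+1); the area is 2 N and ln 2 >
  5/8, so this too is of order exp(-N/8). Plancherel is wanted only for functions that are both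
  integrable and square-integrable, as windowed and truncated functions are; the L2 transform
  \<open>g\<close> is reached as a limit of truncations.\<close>

definition square_integrable :: "'a measure \<Rightarrow> ('a \<Rightarrow> complex) \<Rightarrow> bool" where
  "square_integrable M f \<longleftrightarrow> f \<in> borel_measurable M \<and> integrable M (\<lambda>x. (cmod (f x))\<^sup>2)"

text \<open>Kept over an arbitrary measure so that one calculus serves the line and the phase plane
  \<open>lborel \<Otimes>\<^sub>M lborel\<close>. A non-integrable square gives the default value 0,
  so a bound on \<open>l2norm\<close> has content only together with membership.\<close>

definition l2norm :: "'a measure \<Rightarrow> ('a \<Rightarrow> complex) \<Rightarrow> real" where
  "l2norm M f = sqrt (\<integral>x. (cmod (f x))\<^sup>2 \<partial>M)"

lemma sq_int_eq_square_integrable: "sq_int f \<longleftrightarrow> square_integrable lborel f"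
  by (simp add: sq_int_def square_integrable_def)

lemma L2_norm_eq_l2norm: "L2_norm f = l2norm lborel f"
  by (simp add: L2_norm_def l2norm_def)

lemma l2norm_nonneg [simp]: "0 \<le> l2norm M f"
  by (simp add: l2norm_def)

lemma l2norm_power2: "(l2norm M f)\<^sup>2 = (\<integral>x. (cmod (f x))\<^sup>2 \<partial>M)"
  by (simp add: l2norm_def)

lemma square_integrable_measurable [measurable_dest]:
  "square_integrable M f \<Longrightarrow> f \<in> borel_measurable M"
  by (simp add: square_integrable_def)

lemma square_integrable_mono:
  assumes "square_integrable M f" "g \<in> borel_measurable M" "\<And>x. x \<in> space M \<Longrightarrow> cmod (g x) \<le> cmod (f x)"
  shows "square_integrable M g" "l2norm M g \<le> l2norm M f"
proof -
  show 1: "square_integrable M g"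
    unfolding square_integrable_def
    using assms by (auto simp: square_integrable_def intro!: Bochner_Integration.integrable_bound[where g="\<lambda>x. (cmod (g x))\<^sup>2" and f="\<lambda>x. (cmod (f x))\<^sup>2"]
        AE_I2 power_mono)
  show "l2norm M g \<le> l2norm M f"
    unfolding l2norm_def using 1 assms
    by (auto intro!: real_sqrt_le_mono integral_mono power_mono simp: square_integrable_def)
qed

lemma nn_integral_square_integrable:
  assumes "square_integrable M f"
  shows "(\<integral>\<^sup>+x. ennreal ((cmod (f x))\<^sup>2) \<partial>M) = ennreal ((l2norm M f)\<^sup>2)"
  using assms unfolding square_integrable_def l2norm_power2
  by (intro nn_integral_eq_integral) auto

text \<open>The exit from extended nonnegative integrals: Tonelli computations end in a bound there,
  and a finite one gives membership and the norm estimate at once.\<close>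

lemma square_integrableI_nn_integral:
  assumes "f \<in> borel_measurable M" "(\<integral>\<^sup>+x. ennreal ((cmod (f x))\<^sup>2) \<partial>M) \<le> ennreal c" "0 \<le> c"
  shows "square_integrable M f" "(l2norm M f)\<^sup>2 \<le> c"
proof -
  note [measurable] = assms(1)
  show 1: "square_integrable M f"
    unfolding square_integrable_def using assms(2)
    by (auto intro!: integrableI_bounded simp: top_unique less_top[symmetric])
  show "(l2norm M f)\<^sup>2 \<le> c"
    using assms(2,3) nn_integral_square_integrable[OF 1] by simp
qed

text \<open>Proved first in the extended nonnegative reals, where every integral has a value;
  finiteness of the right-hand side then yields integrability of the product, and only afterwards is
  the inequality transferred to real integrals.\<close>

lemma Cauchy_Schwarz_integral:
  assumes f: "square_integrable M f" and g: "square_integrable M g"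
  shows "integrable M (\<lambda>x. cmod (f x) * cmod (g x))"
    and "(\<integral>x. cmod (f x) * cmod (g x) \<partial>M) \<le> l2norm M f * l2norm M g"
proof -
  note [measurable] = f g
  let ?I = "\<integral>\<^sup>+x. ennreal (cmod (f x) * cmod (g x)) \<partial>M"
  have "?I\<^sup>2 \<le> (\<integral>\<^sup>+x. (ennreal (cmod (f x)))\<^sup>2 \<partial>M) * (\<integral>\<^sup>+x. (ennreal (cmod (g x)))\<^sup>2 \<partial>M)"
    using Cauchy_Schwarz_nn_integral[of "\<lambda>x. ennreal (cmod (f x))" M "\<lambda>x. ennreal (cmod (g x))"]
    by (simp add: ennreal_mult)
  also have "\<dots> = ennreal ((l2norm M f * l2norm M g)\<^sup>2)"
    using nn_integral_square_integrable[OF f] nn_integral_square_integrable[OF g]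
    by (simp add: ennreal_power ennreal_mult power_mult_distrib)
  finally have le: "?I\<^sup>2 \<le> ennreal ((l2norm M f * l2norm M g)\<^sup>2)" .
  have fin: "?I < \<infinity>"
  proof (rule ccontr)
    assume "\<not> ?I < \<infinity>"
    then have "?I = \<infinity>" by (metis infinity_ennreal_def less_top)
    then have "?I\<^sup>2 = \<infinity>" by (simp add: power2_eq_square ennreal_top_mult)
    with le show False by (simp add: top_unique)
  qed
  show int: "integrable M (\<lambda>x. cmod (f x) * cmod (g x))"
    using fin by (intro integrableI_bounded) auto
  have eq: "?I = ennreal (\<integral>x. cmod (f x) * cmod (g x) \<partial>M)"
    using int by (intro nn_integral_eq_integral) auto
  have nn: "0 \<le> (\<integral>x. cmod (f x) * cmod (g x) \<partial>M)" by simp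
  have "(\<integral>x. cmod (f x) * cmod (g x) \<partial>M)\<^sup>2 \<le> (l2norm M f * l2norm M g)\<^sup>2"
    using le unfolding eq by (simp add: ennreal_power)
  then show "(\<integral>x. cmod (f x) * cmod (g x) \<partial>M) \<le> l2norm M f * l2norm M g"
    by (rule power2_le_imp_le) simp
qed

lemma square_integrable_mult_integrable:
  assumes f: "square_integrable M f" and g: "square_integrable M g"
  shows "integrable M (\<lambda>x. f x * g x)"
    and "cmod (\<integral>x. f x * g x \<partial>M) \<le> l2norm M f * l2norm M g"
proof -
  note [measurable] = f g
  show "integrable M (\<lambda>x. f x * g x)"
    by (rule Bochner_Integration.integrable_bound[OF Cauchy_Schwarz_integral(1)[OF f g]])
       (auto simp: norm_mult)
  have "cmod (\<integral>x. f x * g x \<partial>M) \<le> (\<integral>x. cmod (f x * g x) \<partial>M)" by simp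
  also have "\<dots> \<le> l2norm M f * l2norm M g"
    using Cauchy_Schwarz_integral(2)[OF f g] by (simp add: norm_mult)
  finally show "cmod (\<integral>x. f x * g x \<partial>M) \<le> l2norm M f * l2norm M g" .
qed

lemma measurable_cnj [measurable (raw)]:
  "f \<in> borel_measurable M \<Longrightarrow> (\<lambda>x. cnj (f x)) \<in> borel_measurable M"
  by (rule borel_measurable_continuous_on[where f=cnj]) (auto intro: continuous_intros)

lemma square_integrable_cnj: "square_integrable M f \<Longrightarrow> square_integrable M (\<lambda>x. cnj (f x))"
  by (auto simp: square_integrable_def)

lemma square_integrable_cmult: "square_integrable M f \<Longrightarrow> square_integrable M (\<lambda>x. c * f x)"
  by (auto simp: square_integrable_def norm_mult power_mult_distrib)

lemma l2norm_cmult: "l2norm M (\<lambda>x. c * f x) = cmod c * l2norm M f"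
  by (simp add: l2norm_def norm_mult power_mult_distrib real_sqrt_mult)

lemma square_integrable_add:
  assumes f: "square_integrable M f" and g: "square_integrable M g"
  shows "square_integrable M (\<lambda>x. f x + g x)"
    and "l2norm M (\<lambda>x. f x + g x) \<le> l2norm M f + l2norm M g"
proof -
  note [measurable] = f g
  have f2: "integrable M (\<lambda>x. (cmod (f x))\<^sup>2)" and g2: "integrable M (\<lambda>x. (cmod (g x))\<^sup>2)"
    using f g by (auto simp: square_integrable_def)
  note fg = Cauchy_Schwarz_integral[OF f g]
  have i: "integrable M (\<lambda>x. (cmod (f x))\<^sup>2 + 2 * (cmod (f x) * cmod (g x)) + (cmod (g x))\<^sup>2)"
    using f2 g2 fg(1) by auto
  have le: "(cmod (f x + g x))\<^sup>2 \<le> (cmod (f x))\<^sup>2 + 2 * (cmod (f x) * cmod (g x)) + (cmod (g x))\<^sup>2" for x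
    using power_mono[OF norm_triangle_ineq[of "f x" "g x"], of 2] by (simp add: power2_sum algebra_simps)
  show 1: "square_integrable M (\<lambda>x. f x + g x)"
    unfolding square_integrable_def
    by (auto intro!: Bochner_Integration.integrable_bound[OF i] AE_I2 order_trans[OF le])
  have "(l2norm M (\<lambda>x. f x + g x))\<^sup>2
     \<le> (\<integral>x. (cmod (f x))\<^sup>2 + 2 * (cmod (f x) * cmod (g x)) + (cmod (g x))\<^sup>2 \<partial>M)"
    unfolding l2norm_power2 using 1 le i by (auto intro!: integral_mono simp: square_integrable_def)
  also have "\<dots> = (l2norm M f)\<^sup>2 + 2 * (\<integral>x. cmod (f x) * cmod (g x) \<partial>M) + (l2norm M g)\<^sup>2"
    using f2 g2 fg(1) by (simp add: l2norm_power2)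
  also have "\<dots> \<le> (l2norm M f + l2norm M g)\<^sup>2"
    using fg(2) by (simp add: power2_sum)
  finally show "l2norm M (\<lambda>x. f x + g x) \<le> l2norm M f + l2norm M g"
    by (rule power2_le_imp_le) simp
qed

lemma square_integrable_diff:
  assumes f: "square_integrable M f" and g: "square_integrable M g"
  shows "square_integrable M (\<lambda>x. f x - g x)"
    and "l2norm M (\<lambda>x. f x - g x) \<le> l2norm M f + l2norm M g"
    and "l2norm M f \<le> l2norm M g + l2norm M (\<lambda>x. f x - g x)"
proof -
  have g': "square_integrable M (\<lambda>x. - 1 * g x)" by (rule square_integrable_cmult[OF g])
  show d: "square_integrable M (\<lambda>x. f x - g x)"
    using square_integrable_add(1)[OF f g'] by simp
  show "l2norm M (\<lambda>x. f x - g x) \<le> l2norm M f + l2norm M g"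
    using square_integrable_add(2)[OF f g'] l2norm_cmult[of M "-1" g] by simp
  show "l2norm M f \<le> l2norm M g + l2norm M (\<lambda>x. f x - g x)"
    using square_integrable_add(2)[OF g d] by simp
qed

lemma square_integrable_indicator:
  assumes "square_integrable M f" "A \<in> sets M"
  shows "square_integrable M (\<lambda>x. indicator A x * f x)"
    and "l2norm M (\<lambda>x. indicator A x * f x) \<le> l2norm M f"
proof -
  note [measurable] = assms
  have m: "(\<lambda>x. indicator A x * f x) \<in> borel_measurable M" by measurable
  have le: "cmod (indicator A x * f x) \<le> cmod (f x)" for x by (auto split: split_indicator)
  show "square_integrable M (\<lambda>x. indicator A x * f x)" 
    by (rule square_integrable_mono(1)[OF assms(1) m le])
  show "l2norm M (\<lambda>x. indicator A x * f x) \<le> l2norm M f"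
    by (rule square_integrable_mono(2)[OF assms(1) m le])
qed

section \<open>Gaussian integrals\<close>

lemma gaussian_integral:
  fixes b c :: real
  assumes b: "b > 0"
  shows "integrable lborel (\<lambda>x. exp (- (b\<^sup>2 * (x - c)\<^sup>2)))"
    and "(\<integral>x. exp (- (b\<^sup>2 * (x - c)\<^sup>2)) \<partial>lborel) = sqrt pi / b"
proof -
  define \<sigma> where "\<sigma> = 1 / (sqrt 2 * b)"
  have s: "\<sigma> > 0" "2 * \<sigma>\<^sup>2 = 1 / b\<^sup>2" using b by (auto simp: \<sigma>_def power_divide power_mult_distrib)
  have n: "normal_density c \<sigma> x = b / sqrt pi * exp (- (b\<^sup>2 * (x - c)\<^sup>2))" for x
  proof -
    have "normal_density c \<sigma> x = 1 / sqrt (pi * (2 * \<sigma>\<^sup>2)) * exp (- (x - c)\<^sup>2 / (2 * \<sigma>\<^sup>2))"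
      by (simp add: normal_density_def mult_ac)
    also have "\<dots> = b / sqrt pi * exp (- (b\<^sup>2 * (x - c)\<^sup>2))"
      unfolding s(2) using b by (simp add: real_sqrt_divide mult.commute)
    finally show ?thesis .
  qed
  have e: "exp (- (b\<^sup>2 * (x - c)\<^sup>2)) = sqrt pi / b * normal_density c \<sigma> x" for x
    unfolding n using b by simp
  show "integrable lborel (\<lambda>x. exp (- (b\<^sup>2 * (x - c)\<^sup>2)))"
    unfolding e using integrable_normal_density[OF s(1)] by simp
  show "(\<integral>x. exp (- (b\<^sup>2 * (x - c)\<^sup>2)) \<partial>lborel) = sqrt pi / b"
    unfolding e using integral_normal_density[OF s(1)] by simp
qed

lemma gaussian_half_integral:
  fixes b c :: real
  assumes b: "b > 0"
  shows "integrable lborel (\<lambda>x. exp (- (b\<^sup>2 * (x - c)\<^sup>2) / 2))"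
    and "(\<integral>x. exp (- (b\<^sup>2 * (x - c)\<^sup>2) / 2) \<partial>lborel) = sqrt (2 * pi) / b"
proof -
  have "(b / sqrt 2)\<^sup>2 * y = b\<^sup>2 * y / 2" for y by (simp add: power_divide)
  with gaussian_integral[of "b / sqrt 2" c] b
  show "integrable lborel (\<lambda>x. exp (- (b\<^sup>2 * (x - c)\<^sup>2) / 2))"
    "(\<integral>x. exp (- (b\<^sup>2 * (x - c)\<^sup>2) / 2) \<partial>lborel) = sqrt (2 * pi) / b"
    by (auto simp: real_sqrt_mult)
qed

text \<open>Unnormalised, so Plancherel carries the factor 2 pi and \<open>fourier_trunc\<close> is
  a constant multiple of a value of \<open>ft\<close>. As a Bochner integral it is meaningful only
  for integrable \<open>f\<close>; square-integrable functions are windowed or truncated before it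
  is applied.\<close>

definition ft :: "(real \<Rightarrow> complex) \<Rightarrow> real \<Rightarrow> complex" where
  "ft f k = (\<integral>x. f x * exp (- \<i> * complex_of_real (k * x)) \<partial>lborel)"

text \<open>Read off from the characteristic function of the standard normal law by clearing the
  normalisation of the density.\<close>

lemma ft_gaussian_std:
  "(\<integral>x. complex_of_real (exp (- x\<^sup>2 / 2)) * exp (\<i> * complex_of_real (t * x)) \<partial>lborel)
     = complex_of_real (sqrt (2 * pi) * exp (- t\<^sup>2 / 2))"
proof -
  have "complex_of_real (exp (- t\<^sup>2 / 2)) = char std_normal_distribution t"
    by (simp add: char_std_normal_distribution)
  also have "\<dots> = (\<integral>x. std_normal_density x *\<^sub>R exp (\<i> * complex_of_real (t * x)) \<partial>lborel)"
    unfolding char_def by (subst integral_density) (auto simp: normal_density_nonneg)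
  also have "\<dots> = (\<integral>x. complex_of_real (1 / sqrt (2 * pi)) * (complex_of_real (exp (- x\<^sup>2 / 2)) * exp (\<i> * complex_of_real (t * x))) \<partial>lborel)"
    by (simp add: std_normal_density_def scaleR_conv_of_real mult_ac)
  also have "\<dots> = complex_of_real (1 / sqrt (2 * pi)) * (\<integral>x. complex_of_real (exp (- x\<^sup>2 / 2)) * exp (\<i> * complex_of_real (t * x)) \<partial>lborel)"
    by (rule integral_mult_right_zero)
  finally show ?thesis by (simp add: field_simps)
qed

lemma ft_gaussian:
  fixes b c :: real
  assumes b: "b > 0"
  shows "ft (\<lambda>x. complex_of_real (exp (- (b\<^sup>2 * (x - c)\<^sup>2) / 2))) k
     = complex_of_real (sqrt (2 * pi) / b * exp (- k\<^sup>2 / (2 * b\<^sup>2))) * exp (- \<i> * complex_of_real (k * c))"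
proof -
  have "ft (\<lambda>x. complex_of_real (exp (- (b\<^sup>2 * (x - c)\<^sup>2) / 2))) k
     = \<bar>1/b\<bar> *\<^sub>R (\<integral>x. complex_of_real (exp (- (b\<^sup>2 * (c + (1/b) * x - c)\<^sup>2) / 2)) * exp (- \<i> * complex_of_real (k * (c + (1/b) * x))) \<partial>lborel)"
    unfolding ft_def by (rule lborel_integral_real_affine) (use b in simp)
  also have "(\<lambda>x. complex_of_real (exp (- (b\<^sup>2 * (c + (1/b) * x - c)\<^sup>2) / 2)) * exp (- \<i> * complex_of_real (k * (c + (1/b) * x))))
    = (\<lambda>x. exp (- \<i> * complex_of_real (k * c)) * (complex_of_real (exp (- x\<^sup>2 / 2)) * exp (\<i> * complex_of_real ((- k / b) * x))))"
    using b by (auto simp: fun_eq_iff power_divide exp_add[symmetric] algebra_simps simp flip: exp_of_real)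
  also have "(\<integral>x. \<dots> x \<partial>lborel) = exp (- \<i> * complex_of_real (k * c)) * complex_of_real (sqrt (2 * pi) * exp (- (- k / b)\<^sup>2 / 2))"
    by (subst integral_mult_right_zero) (simp only: ft_gaussian_std)
  finally show ?thesis using b by (simp add: scaleR_conv_of_real power_divide mult_ac)
qed

section \<open>The Fourier transform and Plancherel's theorem\<close>

lemma measurable_ft [measurable]:
  assumes [measurable]: "f \<in> borel_measurable borel"
  shows "ft f \<in> borel_measurable borel"
  unfolding ft_def[abs_def] by measurable

lemma cmod_ft_le:
  "cmod (ft f k) \<le> (\<integral>x. cmod (f x) \<partial>lborel)"
proof -
  have "cmod (ft f k) \<le> (\<integral>x. cmod (f x * exp (- \<i> * complex_of_real (k * x))) \<partial>lborel)"
    unfolding ft_def by (rule integral_norm_bound)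
  then show ?thesis by (simp add: norm_mult)
qed

lemma integrable_mult_exp_ii:
  assumes "integrable lborel f"
  shows "integrable lborel (\<lambda>x. f x * exp (- \<i> * complex_of_real (k * x)))"
  by (rule Bochner_Integration.integrable_bound[OF assms]) (use assms in \<open>auto simp: norm_mult\<close>)

lemma ft_diff:
  assumes "integrable lborel f" "integrable lborel g"
  shows "ft (\<lambda>x. f x - g x) k = ft f k - ft g k"
  using Bochner_Integration.integral_diff[OF integrable_mult_exp_ii[OF assms(1), of k] integrable_mult_exp_ii[OF assms(2), of k]]
  by (simp add: ft_def algebra_simps)

text \<open>The kernel is symmetric in position and frequency, so swapping the integrals moves the
  transform from \<open>f\<close> to \<open>g\<close>; the product of |f(x)| and |g(k)| is the
  modulus of the double integrand, which justifies Fubini.\<close>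

lemma ft_multiplication_formula:
  assumes f: "integrable lborel f" and g: "integrable lborel g"
  shows "(\<integral>k. ft f k * g k \<partial>lborel) = (\<integral>x. f x * ft g x \<partial>lborel)"
proof -
  have [measurable]: "f \<in> borel_measurable borel" "g \<in> borel_measurable borel"
    using f g by (auto simp: integrable_iff_bounded)
  have int: "integrable (lborel \<Otimes>\<^sub>M lborel) (\<lambda>(x, k). f x * exp (- \<i> * complex_of_real (k * x)) * g k)"
  proof (rule lborel_pair.Fubini_integrable)
    show "AE x in lborel. integrable lborel (\<lambda>y. case (x, y) of (x, k) \<Rightarrow> f x * exp (- \<i> * complex_of_real (k * x)) * g k)"
    proof (rule AE_I2, unfold prod.case)
      fix x
      show "integrable lborel (\<lambda>k. f x * exp (- \<i> * complex_of_real (k * x)) * g k)"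
        by (rule Bochner_Integration.integrable_bound[OF integrable_mult_right[OF g, of "f x"]]) (auto simp: norm_mult)
    qed
    show "integrable lborel (\<lambda>x. \<integral>y. cmod (case (x, y) of (x, k) \<Rightarrow> f x * exp (- \<i> * complex_of_real (k * x)) * g k) \<partial>lborel)"
      using f by (simp add: norm_mult)
  qed measurable
  have "(\<integral>k. ft f k * g k \<partial>lborel) = (\<integral>k. (\<integral>x. f x * exp (- \<i> * complex_of_real (k * x)) * g k \<partial>lborel) \<partial>lborel)"
    by (simp add: ft_def)
  also have "\<dots> = (\<integral>x. (\<integral>k. f x * exp (- \<i> * complex_of_real (k * x)) * g k \<partial>lborel) \<partial>lborel)"
    by (rule lborel_pair.Fubini_integral[OF int])
  also have "\<dots> = (\<integral>x. (\<integral>k. f x * (g k * exp (- \<i> * complex_of_real (x * k))) \<partial>lborel) \<partial>lborel)"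
    by (simp add: mult_ac)
  also have "\<dots> = (\<integral>x. f x * ft g x \<partial>lborel)"
    by (simp only: integral_mult_right_zero ft_def)
  finally show ?thesis .
qed

section \<open>Plancherel's theorem by Gaussian regularisation\<close>

lemma ennreal_cmod_integral_le:
  "ennreal (cmod (\<integral>x. f x \<partial>M)) \<le> (\<integral>\<^sup>+x. ennreal (cmod (f x)) \<partial>M)"
  by (cases "integrable M f") (auto simp: integral_norm_bound_ennreal not_integrable_integral_eq)

text \<open>Modulation in \<open>k\<close> becomes translation by \<open>x\<close>, so the transform
  is an approximate identity around \<open>x\<close>: its mass stays 2 pi while its width is
  \<open>b\<close>. This is the mollifier hidden behind a Gaussian cut-off in frequency.\<close>

lemma ft_modulated_gaussian:
  assumes b: "b > 0"
  shows "integrable lborel (\<lambda>k. complex_of_real (exp (- (b\<^sup>2 * k\<^sup>2) / 2)) * exp (\<i> * complex_of_real (x * k)))"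
    and "ft (\<lambda>k. complex_of_real (exp (- (b\<^sup>2 * k\<^sup>2) / 2)) * exp (\<i> * complex_of_real (x * k))) y
       = complex_of_real (sqrt (2 * pi) / b * exp (- (y - x)\<^sup>2 / (2 * b\<^sup>2)))"
proof -
  have i: "integrable lborel (\<lambda>k. complex_of_real (exp (- (b\<^sup>2 * k\<^sup>2) / 2)))"
    using gaussian_half_integral(1)[OF b, of 0] by simp
  show "integrable lborel (\<lambda>k. complex_of_real (exp (- (b\<^sup>2 * k\<^sup>2) / 2)) * exp (\<i> * complex_of_real (x * k)))"
    by (rule Bochner_Integration.integrable_bound[OF i]) (auto simp: norm_mult)
  have "ft (\<lambda>k. complex_of_real (exp (- (b\<^sup>2 * k\<^sup>2) / 2)) * exp (\<i> * complex_of_real (x * k))) y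
      = ft (\<lambda>k. complex_of_real (exp (- (b\<^sup>2 * (k - 0)\<^sup>2) / 2))) (y - x)"
    unfolding ft_def
    by (rule Bochner_Integration.integral_cong) (auto simp: exp_add[symmetric] algebra_simps)
  also have "\<dots> = complex_of_real (sqrt (2 * pi) / b * exp (- (y - x)\<^sup>2 / (2 * b\<^sup>2)))"
    by (subst ft_gaussian[OF b]) simp
  finally show "ft (\<lambda>k. complex_of_real (exp (- (b\<^sup>2 * k\<^sup>2) / 2)) * exp (\<i> * complex_of_real (x * k))) y
       = complex_of_real (sqrt (2 * pi) / b * exp (- (y - x)\<^sup>2 / (2 * b\<^sup>2)))" .
qed

text \<open>Integrating \<open>\<bar>ft f\<bar>\<^sup>2\<close> against a Gaussian of width \<open>1/b\<close> amounts to mollifying \<open>f\<close> at scale \<open>b\<close>;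
  Plancherel's theorem is the limit \<open>b \<rightarrow> 0\<close>.\<close>

lemma plancherel_regularised:
  assumes f: "integrable lborel f" and b: "b > 0"
  shows "complex_of_real (\<integral>k. (cmod (ft f k))\<^sup>2 * exp (- (b\<^sup>2 * k\<^sup>2) / 2) \<partial>lborel)
    = (\<integral>x. f x * cnj (\<integral>s. f (x + b * s) * complex_of_real (sqrt (2 * pi) * exp (- s\<^sup>2 / 2)) \<partial>lborel) \<partial>lborel)"
proof -
  have [measurable]: "f \<in> borel_measurable borel" using f by (auto simp: integrable_iff_bounded)
  let ?g = "\<lambda>k. complex_of_real (exp (- (b\<^sup>2 * k\<^sup>2) / 2))"
  let ?h = "\<lambda>k. cnj (ft f k) * ?g k"
  have gi: "integrable lborel (\<lambda>k. exp (- (b\<^sup>2 * k\<^sup>2) / 2))"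
    using gaussian_half_integral(1)[OF b, of 0] by simp
  have hi: "integrable lborel ?h"
    by (rule Bochner_Integration.integrable_bound[OF integrable_mult_right[OF gi, of "\<integral>x. cmod (f x) \<partial>lborel"]])
       (auto simp: norm_mult intro!: mult_right_mono cmod_ft_le)
  have inner: "ft ?h x = cnj (\<integral>s. f (x + b * s) * complex_of_real (sqrt (2 * pi) * exp (- s\<^sup>2 / 2)) \<partial>lborel)" for x
  proof -
    have "ft ?h x = cnj (\<integral>k. ft f k * (?g k * exp (\<i> * complex_of_real (x * k))) \<partial>lborel)"
      unfolding ft_def[of ?h]
      by (subst Bochner_Integration.integral_cnj[symmetric], rule Bochner_Integration.integral_cong) (simp_all add: exp_cnj mult_ac)
    also have "(\<integral>k. ft f k * (?g k * exp (\<i> * complex_of_real (x * k))) \<partial>lborel)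
      = (\<integral>y. f y * ft (\<lambda>k. ?g k * exp (\<i> * complex_of_real (x * k))) y \<partial>lborel)"
      by (rule ft_multiplication_formula[OF f ft_modulated_gaussian(1)[OF b]])
    also have "\<dots> = (\<integral>y. f y * complex_of_real (sqrt (2 * pi) / b * exp (- (y - x)\<^sup>2 / (2 * b\<^sup>2))) \<partial>lborel)"
      unfolding ft_modulated_gaussian(2)[OF b] ..
    \<comment> \<open>The substitution y = x + b s frees the Gaussian of \<open>b\<close>, which
      survives only in the argument of \<open>f\<close>: the form suited to the limit b ->
      0.\<close>
    also have "\<dots> = \<bar>b\<bar> *\<^sub>R (\<integral>s. f (x + b * s) * complex_of_real (sqrt (2 * pi) / b * exp (- (x + b * s - x)\<^sup>2 / (2 * b\<^sup>2))) \<partial>lborel)"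
      by (rule lborel_integral_real_affine) (use b in simp)
    also have "\<dots> = (\<integral>s. complex_of_real b * (f (x + b * s) * complex_of_real (sqrt (2 * pi) / b * exp (- (x + b * s - x)\<^sup>2 / (2 * b\<^sup>2)))) \<partial>lborel)"
      using b by (simp add: scaleR_conv_of_real)
    also have "\<dots> = (\<integral>s. f (x + b * s) * complex_of_real (sqrt (2 * pi) * exp (- s\<^sup>2 / 2)) \<partial>lborel)"
      using b by (intro Bochner_Integration.integral_cong) (auto simp: power_mult_distrib)
    finally show ?thesis .
  qed
  have "complex_of_real (\<integral>k. (cmod (ft f k))\<^sup>2 * exp (- (b\<^sup>2 * k\<^sup>2) / 2) \<partial>lborel)
      = (\<integral>k. complex_of_real ((cmod (ft f k))\<^sup>2 * exp (- (b\<^sup>2 * k\<^sup>2) / 2)) \<partial>lborel)"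
    by (rule integral_complex_of_real[symmetric])
  also have "\<dots> = (\<integral>k. ft f k * ?h k \<partial>lborel)"
    by (intro Bochner_Integration.integral_cong) (simp_all only: of_real_mult complex_norm_square mult_ac)
  also have "\<dots> = (\<integral>x. f x * ft ?h x \<partial>lborel)"
    by (rule ft_multiplication_formula[OF f hi])
  finally show ?thesis unfolding inner .
qed

lemma square_integrable_affine:
  fixes t c :: real
  assumes "square_integrable lborel f" "c \<noteq> 0"
  shows "square_integrable lborel (\<lambda>x. f (t + c * x))"
  using assms lborel_integrable_real_affine[of "\<lambda>x. (cmod (f x))\<^sup>2" c t]
  by (auto simp: square_integrable_def)

lemma l2norm_translate:
  fixes f :: "real \<Rightarrow> complex"
  shows "l2norm lborel (\<lambda>x. f (x + t)) = l2norm lborel f"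
  using lborel_integral_real_affine[of 1 "\<lambda>x. (cmod (f x))\<^sup>2" t] by (simp add: l2norm_def add.commute)

text \<open>After absolute values and Tonelli the inner integral is the correlation of |f| with a
  translate of itself, at most the squared norm by Cauchy-Schwarz; the Gaussian contributes its mass
  2 pi. The bound is uniform in \<open>b\<close>.\<close>

lemma plancherel_regularised_le:
  assumes f: "integrable lborel f" and f2: "square_integrable lborel f" and b: "b > 0"
  shows "(\<integral>\<^sup>+k. ennreal ((cmod (ft f k))\<^sup>2 * exp (- (b\<^sup>2 * k\<^sup>2) / 2)) \<partial>lborel) \<le> ennreal (2 * pi * (l2norm lborel f)\<^sup>2)"
proof -
  have [measurable]: "f \<in> borel_measurable borel" using f by (auto simp: integrable_iff_bounded)
  let ?G = "\<lambda>s::real. sqrt (2 * pi) * exp (- s\<^sup>2 / 2)"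
  have gi: "integrable lborel (\<lambda>k. exp (- (b\<^sup>2 * k\<^sup>2) / 2))"
    using gaussian_half_integral(1)[OF b, of 0] by simp
  have i: "integrable lborel (\<lambda>k. (cmod (ft f k))\<^sup>2 * exp (- (b\<^sup>2 * k\<^sup>2) / 2))"
    by (rule Bochner_Integration.integrable_bound[OF integrable_mult_right[OF gi, of "(\<integral>x. cmod (f x) \<partial>lborel)\<^sup>2"]])
       (auto simp: norm_mult intro!: mult_right_mono power_mono cmod_ft_le)
  have G: "integrable lborel ?G" "(\<integral>s. ?G s \<partial>lborel) = 2 * pi"
    using gaussian_half_integral[of 1 0] by auto
  have tr: "(\<integral>\<^sup>+x. ennreal (cmod (f x) * cmod (f (x + t))) \<partial>lborel) \<le> ennreal ((l2norm lborel f)\<^sup>2)" for t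
  proof -
    have ft2: "square_integrable lborel (\<lambda>x. f (x + t))"
      using square_integrable_affine[OF f2, of 1 t] by (simp add: add.commute)
    show ?thesis
      using Cauchy_Schwarz_integral[OF f2 ft2]
      by (subst nn_integral_eq_integral) (auto simp: l2norm_translate power2_eq_square)
  qed
  have "(\<integral>\<^sup>+k. ennreal ((cmod (ft f k))\<^sup>2 * exp (- (b\<^sup>2 * k\<^sup>2) / 2)) \<partial>lborel)
      = ennreal (cmod (complex_of_real (\<integral>k. (cmod (ft f k))\<^sup>2 * exp (- (b\<^sup>2 * k\<^sup>2) / 2) \<partial>lborel)))"
    using i by (subst nn_integral_eq_integral) auto
  also have "\<dots> \<le> (\<integral>\<^sup>+x. ennreal (cmod (f x * cnj (\<integral>s. f (x + b * s) * complex_of_real (?G s) \<partial>lborel))) \<partial>lborel)"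
    unfolding plancherel_regularised[OF f b] by (rule ennreal_cmod_integral_le)
  also have "\<dots> \<le> (\<integral>\<^sup>+x. (\<integral>\<^sup>+s. ennreal (cmod (f x) * cmod (f (x + b * s)) * ?G s) \<partial>lborel) \<partial>lborel)"
  proof (rule nn_integral_mono)
    fix x
    have "ennreal (cmod (f x * cnj (\<integral>s. f (x + b * s) * complex_of_real (?G s) \<partial>lborel)))
      = ennreal (cmod (f x)) * ennreal (cmod (\<integral>s. f (x + b * s) * complex_of_real (?G s) \<partial>lborel))"
      by (simp add: norm_mult ennreal_mult)
    also have "\<dots> \<le> ennreal (cmod (f x)) * (\<integral>\<^sup>+s. ennreal (cmod (f (x + b * s) * complex_of_real (?G s))) \<partial>lborel)"
      by (intro mult_left_mono ennreal_cmod_integral_le) auto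
    also have "\<dots> = (\<integral>\<^sup>+s. ennreal (cmod (f x) * cmod (f (x + b * s)) * ?G s) \<partial>lborel)"
      by (subst nn_integral_cmult[symmetric]) (auto simp: norm_mult ennreal_mult mult.assoc)
    finally show "ennreal (cmod (f x * cnj (\<integral>s. f (x + b * s) * complex_of_real (?G s) \<partial>lborel)))
      \<le> (\<integral>\<^sup>+s. ennreal (cmod (f x) * cmod (f (x + b * s)) * ?G s) \<partial>lborel)" .
  qed
  also have "\<dots> = (\<integral>\<^sup>+s. (\<integral>\<^sup>+x. ennreal (cmod (f x) * cmod (f (x + b * s)) * ?G s) \<partial>lborel) \<partial>lborel)"
    by (rule lborel_pair.Fubini'[symmetric]) measurable
  also have "\<dots> = (\<integral>\<^sup>+s. (\<integral>\<^sup>+x. ennreal (cmod (f x) * cmod (f (x + b * s))) \<partial>lborel) * ennreal (?G s) \<partial>lborel)"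
    by (subst nn_integral_multc[symmetric]) (auto simp: ennreal_mult)
  also have "\<dots> \<le> (\<integral>\<^sup>+s. ennreal ((l2norm lborel f)\<^sup>2) * ennreal (?G s) \<partial>lborel)"
    by (intro nn_integral_mono mult_right_mono tr) auto
  also have "\<dots> = ennreal ((l2norm lborel f)\<^sup>2) * ennreal (2 * pi)"
    using G by (subst nn_integral_cmult) (auto simp: nn_integral_eq_integral)
  finally show ?thesis by (simp add: ennreal_mult mult_ac)
qed

text \<open>Monotone convergence: as \<open>b\<close> decreases to 0 the Gaussian cut-off increases
  to 1, while the bound on the regularised integral does not depend on \<open>b\<close>.\<close>

lemma plancherel_le:
  assumes f: "integrable lborel f" and f2: "square_integrable lborel f"
  shows "square_integrable lborel (ft f)" and "(l2norm lborel (ft f))\<^sup>2 \<le> 2 * pi * (l2norm lborel f)\<^sup>2"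
proof -
  have [measurable]: "f \<in> borel_measurable borel" using f by (auto simp: integrable_iff_bounded)
  let ?b = "\<lambda>n. inverse (real (Suc n))"
  have b0: "?b \<longlonglongrightarrow> 0" by (rule LIMSEQ_inverse_real_of_nat)
  have "(\<lambda>n. \<integral>\<^sup>+k. ennreal ((cmod (ft f k))\<^sup>2 * exp (- ((?b n)\<^sup>2 * k\<^sup>2) / 2)) \<partial>lborel)
      \<longlonglongrightarrow> (\<integral>\<^sup>+k. ennreal ((cmod (ft f k))\<^sup>2) \<partial>lborel)"
  proof (rule nn_integral_LIMSEQ)
    show "incseq (\<lambda>n k. ennreal ((cmod (ft f k))\<^sup>2 * exp (- ((?b n)\<^sup>2 * k\<^sup>2) / 2)))"
      unfolding incseq_def le_fun_def
      by (auto intro!: ennreal_leI mult_left_mono mult_right_mono power_mono simp: divide_simps)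
    show "(\<lambda>n. ennreal ((cmod (ft f k))\<^sup>2 * exp (- ((?b n)\<^sup>2 * k\<^sup>2) / 2))) \<longlonglongrightarrow> ennreal ((cmod (ft f k))\<^sup>2)" for k
    proof (rule tendsto_ennrealI)
      have "(\<lambda>n. (cmod (ft f k))\<^sup>2 * exp (- ((?b n)\<^sup>2 * k\<^sup>2) / 2)) \<longlonglongrightarrow> (cmod (ft f k))\<^sup>2 * exp (- (0\<^sup>2 * k\<^sup>2) / 2)"
        by (intro tendsto_intros b0) auto
      then show "(\<lambda>n. (cmod (ft f k))\<^sup>2 * exp (- ((?b n)\<^sup>2 * k\<^sup>2) / 2)) \<longlonglongrightarrow> (cmod (ft f k))\<^sup>2" by simp
    qed
  qed measurable
  then have le: "(\<integral>\<^sup>+k. ennreal ((cmod (ft f k))\<^sup>2) \<partial>lborel) \<le> ennreal (2 * pi * (l2norm lborel f)\<^sup>2)"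
    by (rule LIMSEQ_le_const2) (intro exI allI impI plancherel_regularised_le[OF f f2]; simp)
  show "square_integrable lborel (ft f)" "(l2norm lborel (ft f))\<^sup>2 \<le> 2 * pi * (l2norm lborel f)\<^sup>2"
    by (rule square_integrableI_nn_integral[OF _ le]; simp)+
qed

text \<open>Continuity makes the mollified function converge pointwise to 2 pi f, and boundedness
  supplies the majorant for that inner limit; the outer limit is dominated by a multiple of
  |f|.\<close>

lemma plancherel_continuous:
  assumes f: "integrable lborel f" and f2: "square_integrable lborel f"
    and cont: "continuous_on UNIV f" and bdd: "\<And>x. cmod (f x) \<le> B"
  shows "(l2norm lborel (ft f))\<^sup>2 = 2 * pi * (l2norm lborel f)\<^sup>2"
proof -
  have [measurable]: "f \<in> borel_measurable borel" using f by (auto simp: integrable_iff_bounded)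
  let ?b = "\<lambda>n. inverse (real (Suc n))"
  let ?G = "\<lambda>s::real. sqrt (2 * pi) * exp (- s\<^sup>2 / 2)"
  have b0: "?b \<longlonglongrightarrow> 0" by (rule LIMSEQ_inverse_real_of_nat)
  have G: "integrable lborel ?G" "(\<integral>s. ?G s \<partial>lborel) = 2 * pi"
    using gaussian_half_integral[of 1 0] by auto
  have B: "0 \<le> B" using bdd[of 0] norm_ge_zero order_trans by blast
  have ift: "integrable lborel (\<lambda>k. (cmod (ft f k))\<^sup>2)"
    using plancherel_le(1)[OF f f2] by (simp add: square_integrable_def)
  have "(\<lambda>n. \<integral>k. (cmod (ft f k))\<^sup>2 * exp (- ((?b n)\<^sup>2 * k\<^sup>2) / 2) \<partial>lborel) \<longlonglongrightarrow> (\<integral>k. (cmod (ft f k))\<^sup>2 \<partial>lborel)"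
  proof (rule integral_dominated_convergence[OF _ _ ift])
    show "AE k in lborel. (\<lambda>n. (cmod (ft f k))\<^sup>2 * exp (- ((?b n)\<^sup>2 * k\<^sup>2) / 2)) \<longlonglongrightarrow> (cmod (ft f k))\<^sup>2"
    proof (rule AE_I2)
      fix k
      have "(\<lambda>n. (cmod (ft f k))\<^sup>2 * exp (- ((?b n)\<^sup>2 * k\<^sup>2) / 2)) \<longlonglongrightarrow> (cmod (ft f k))\<^sup>2 * exp (- (0\<^sup>2 * k\<^sup>2) / 2)"
        by (intro tendsto_intros b0) auto
      then show "(\<lambda>n. (cmod (ft f k))\<^sup>2 * exp (- ((?b n)\<^sup>2 * k\<^sup>2) / 2)) \<longlonglongrightarrow> (cmod (ft f k))\<^sup>2" by simp
    qed
    show "AE k in lborel. norm ((cmod (ft f k))\<^sup>2 * exp (- ((?b n)\<^sup>2 * k\<^sup>2) / 2)) \<le> (cmod (ft f k))\<^sup>2" for n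
      by (auto simp: norm_mult intro!: mult_left_le)
  qed measurable
  then have lim1: "(\<lambda>n. complex_of_real (\<integral>k. (cmod (ft f k))\<^sup>2 * exp (- ((?b n)\<^sup>2 * k\<^sup>2) / 2) \<partial>lborel))
      \<longlonglongrightarrow> complex_of_real ((l2norm lborel (ft f))\<^sup>2)"
    unfolding l2norm_power2 by (rule tendsto_of_real)
  let ?I = "\<lambda>n x. \<integral>s. f (x + ?b n * s) * complex_of_real (?G s) \<partial>lborel"
  have dom: "cmod (f (x + ?b n * s) * complex_of_real (?G s)) \<le> B * ?G s" for x n s
    by (auto simp: norm_mult intro!: mult_mono bdd B)
  have inner: "(\<lambda>n. ?I n x) \<longlonglongrightarrow> f x * complex_of_real (2 * pi)" for x
  proof -
    have "(\<lambda>n. ?I n x) \<longlonglongrightarrow> (\<integral>s. f x * complex_of_real (?G s) \<partial>lborel)"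
    proof (rule integral_dominated_convergence[where w="\<lambda>s. B * ?G s"])
      show "AE s in lborel. (\<lambda>n. f (x + ?b n * s) * complex_of_real (?G s)) \<longlonglongrightarrow> f x * complex_of_real (?G s)"
      proof (rule AE_I2)
        fix s
        have "(\<lambda>n. x + ?b n * s) \<longlonglongrightarrow> x + 0 * s" by (intro tendsto_intros b0)
        then have "(\<lambda>n. f (x + ?b n * s)) \<longlonglongrightarrow> f x"
          using cont by (intro isCont_tendsto_compose[of x f]) (auto simp: continuous_on_eq_continuous_at)
        then show "(\<lambda>n. f (x + ?b n * s) * complex_of_real (?G s)) \<longlonglongrightarrow> f x * complex_of_real (?G s)"
          by (intro tendsto_intros)
      qed
      show "AE s in lborel. norm (f (x + ?b n * s) * complex_of_real (?G s)) \<le> B * ?G s" for n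
        using dom by blast
    qed (use G in auto)
    also have "(\<integral>s. f x * complex_of_real (?G s) \<partial>lborel) = f x * complex_of_real (2 * pi)"
      using G by (simp add: integral_complex_of_real del: of_real_mult)
    finally show ?thesis .
  qed
  have Ile: "cmod (?I n x) \<le> 2 * pi * B" for n x
  proof -
    have "cmod (?I n x) \<le> (\<integral>s. B * ?G s \<partial>lborel)"
    proof (rule Bochner_Integration.integral_norm_bound_integral)
      show "integrable lborel (\<lambda>s. f (x + ?b n * s) * complex_of_real (?G s))"
        by (rule Bochner_Integration.integrable_bound[OF integrable_mult_right[OF G(1), of B]])
           (measurable, intro AE_I2 order_trans[OF dom], simp)
    qed (use dom G in auto)
    also have "\<dots> = 2 * pi * B" using G by simp
    finally show ?thesis .
  qed
  have "(\<lambda>n. \<integral>x. f x * cnj (?I n x) \<partial>lborel) \<longlonglongrightarrow> (\<integral>x. f x * cnj (f x * complex_of_real (2 * pi)) \<partial>lborel)"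
  proof (rule integral_dominated_convergence[where w="\<lambda>x. cmod (f x) * (2 * pi * B)"])
    show "AE x in lborel. (\<lambda>n. f x * cnj (?I n x)) \<longlonglongrightarrow> f x * cnj (f x * complex_of_real (2 * pi))"
      by (intro AE_I2 tendsto_intros inner)
    show "AE x in lborel. norm (f x * cnj (?I n x)) \<le> cmod (f x) * (2 * pi * B)" for n
      unfolding norm_mult complex_mod_cnj by (intro AE_I2 mult_left_mono Ile) auto
  qed (use f in auto)
  also have "(\<integral>x. f x * cnj (f x * complex_of_real (2 * pi)) \<partial>lborel) = (\<integral>x. complex_of_real (2 * pi * (cmod (f x))\<^sup>2) \<partial>lborel)"
    by (intro Bochner_Integration.integral_cong) (auto simp: complex_norm_square simp del: of_real_power)
  also have "\<dots> = complex_of_real (2 * pi * (l2norm lborel f)\<^sup>2)"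
    unfolding integral_complex_of_real l2norm_power2 by simp
  finally have lim2: "(\<lambda>n. complex_of_real (\<integral>k. (cmod (ft f k))\<^sup>2 * exp (- ((?b n)\<^sup>2 * k\<^sup>2) / 2) \<partial>lborel))
      \<longlonglongrightarrow> complex_of_real (2 * pi * (l2norm lborel f)\<^sup>2)"
    by (subst plancherel_regularised[OF f]) auto
  show ?thesis using LIMSEQ_unique[OF lim1 lim2] of_real_eq_iff by blast
qed

section \<open>Approximation by continuous functions and the Plancherel identity\<close>

lemma l2norm_dominated_convergence:
  fixes d :: "nat \<Rightarrow> 'a \<Rightarrow> complex"
  assumes [measurable]: "\<And>n. d n \<in> borel_measurable M"
    and w: "integrable M (\<lambda>x. (w x)\<^sup>2)"
    and lim: "AE x in M. (\<lambda>n. d n x) \<longlonglongrightarrow> 0"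
    and bdd: "\<And>n. AE x in M. cmod (d n x) \<le> w x"
  shows "(\<lambda>n. l2norm M (d n)) \<longlonglongrightarrow> 0"
proof -
  have "(\<lambda>n. \<integral>x. (cmod (d n x))\<^sup>2 \<partial>M) \<longlonglongrightarrow> (\<integral>x. 0 \<partial>M)"
  proof (rule integral_dominated_convergence[OF _ _ w])
    show "AE x in M. (\<lambda>n. (cmod (d n x))\<^sup>2) \<longlonglongrightarrow> 0"
      using lim
    proof eventually_elim
      fix x assume "(\<lambda>n. d n x) \<longlonglongrightarrow> 0"
      from tendsto_power[OF tendsto_norm[OF this], of 2] show "(\<lambda>n. (cmod (d n x))\<^sup>2) \<longlonglongrightarrow> 0" by simp
    qed
    show "AE x in M. norm ((cmod (d n x))\<^sup>2) \<le> (w x)\<^sup>2" for n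
      using bdd[of n] by eventually_elim (auto intro: power_mono)
  qed auto
  from tendsto_real_sqrt[OF this] show ?thesis by (simp add: l2norm_def)
qed

lemma l2_approx_bounded_support:
  fixes f :: "real \<Rightarrow> complex"
  assumes f: "square_integrable lborel f" and e: "e > 0"
  obtains n :: nat and h where "n > 0" "h \<in> borel_measurable borel"
    "\<And>x. cmod (h x) \<le> real n" "\<And>x. \<bar>x\<bar> > real n \<Longrightarrow> h x = 0"
    "square_integrable lborel (\<lambda>x. f x - h x)" "l2norm lborel (\<lambda>x. f x - h x) < e"
proof -
  have [measurable]: "f \<in> borel_measurable borel" using f by (auto simp: square_integrable_def)
  \<comment> \<open>One parameter cuts off both position and value: at each fixed \<open>x\<close>
    both conditions hold for all large \<open>n\<close>, so the difference is eventually 0.\<close>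
  define h where "h n x = (if \<bar>x\<bar> \<le> real n \<and> cmod (f x) \<le> real n then f x else 0)" for n :: nat and x
  have [measurable]: "h n \<in> borel_measurable borel" for n unfolding h_def[abs_def] by measurable
  have m: "(\<lambda>x. f x - h n x) \<in> borel_measurable lborel" for n by measurable
  have le: "cmod (f x - h n x) \<le> cmod (f x)" for n x by (simp add: h_def)
  have "(\<lambda>n. l2norm lborel (\<lambda>x. f x - h n x)) \<longlonglongrightarrow> 0"
  proof (rule l2norm_dominated_convergence[where w="\<lambda>x. cmod (f x)"])
    show "AE x in lborel. (\<lambda>n. f x - h n x) \<longlonglongrightarrow> 0"
    proof (rule AE_I2)
      fix x
      obtain m :: nat where "\<bar>x\<bar> \<le> real m" "cmod (f x) \<le> real m"
        using real_arch_simple[of "max \<bar>x\<bar> (cmod (f x))"] by auto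
      then have "\<forall>\<^sub>F n in sequentially. f x - h n x = 0"
        by (auto simp: h_def eventually_sequentially intro!: exI[of _ m])
      then show "(\<lambda>n. f x - h n x) \<longlonglongrightarrow> 0" by (rule tendsto_eventually)
    qed
  qed (use f le in \<open>auto simp: square_integrable_def\<close>)
  then have "\<forall>\<^sub>F n in sequentially. l2norm lborel (\<lambda>x. f x - h n x) < e"
    using e by (rule order_tendstoD)
  then have "\<forall>\<^sub>F n in sequentially. l2norm lborel (\<lambda>x. f x - h n x) < e \<and> n > 0"
    using eventually_gt_at_top[of 0] by eventually_elim auto
  then obtain n where n: "l2norm lborel (\<lambda>x. f x - h n x) < e" "n > 0"
    by (auto dest!: eventually_happens'[OF sequentially_bot])
  show ?thesis
    by (rule that[of n "h n"]) (use n square_integrable_mono(1)[OF f m le] in \<open>auto simp: h_def\<close>)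
qed

text \<open>A measurable function is an almost everywhere limit of continuous ones, but these carry
  no bounds. Clipping the modulus and cutting off the support keeps them continuous and provides the
  majorant for convergence in norm.\<close>

lemma l2_approx_continuous_of_bounded_support:
  fixes h :: "real \<Rightarrow> complex"
  assumes n: "n > (0::nat)" and h: "h \<in> borel_measurable borel"
    and bdd: "\<And>x. cmod (h x) \<le> real n" and supp: "\<And>x. \<bar>x\<bar> > real n \<Longrightarrow> h x = 0" and e: "e > 0"
  obtains c where "continuous_on UNIV c" "\<And>x. cmod (c x) \<le> real n * indicator {- real n - 1..real n + 1} x"
    "l2norm lborel (\<lambda>x. h x - c x) < e"
proof -
  note [measurable] = h
  have "h measurable_on UNIV"
    using h by (intro lebesgue_measurable_imp_measurable_on) (auto intro: measurable_completion)
  then obtain Z g where Z: "negligible Z" and g: "\<And>k. continuous_on UNIV (g k)"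
    and lim: "\<And>x. x \<notin> Z \<Longrightarrow> (\<lambda>k. g k x) \<longlonglongrightarrow> h x"
    unfolding measurable_on_def by auto
  \<comment> \<open>\<open>?t\<close> is a trapezoid, 1 on [-n, n] and 0 outside [-n-1, n+1].
    Division by \<open>?m z\<close> fixes every z of modulus at most n and projects the others
    radially onto the circle of radius n. Both leave \<open>h\<close> unchanged, so the limit is
    still \<open>h\<close>.\<close>
  let ?t = "\<lambda>x. max 0 (min 1 (real n + 1 - \<bar>x\<bar>))"
  let ?m = "\<lambda>z. max 1 (cmod z / real n)"
  define c where "c k x = complex_of_real (?t x) * (g k x / complex_of_real (?m (g k x)))" for k x
  have cont: "continuous_on UNIV (c k)" for k
    unfolding c_def by (intro continuous_intros g) (use n in auto)
  then have [measurable]: "c k \<in> borel_measurable borel" for k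
    by (rule borel_measurable_continuous_onI)
  let ?W = "\<lambda>x. real n * indicator {- real n - 1..real n + 1} x :: real"
  have clip: "cmod (z / complex_of_real (?m z)) \<le> real n" for z
  proof -
    have "cmod z = cmod z / real n * real n" using n by simp
    also have "\<dots> \<le> ?m z * real n" by (intro mult_right_mono) auto
    finally show ?thesis by (simp add: norm_divide divide_le_eq mult.commute)
  qed
  have c_le: "cmod (c k x) \<le> ?W x" for k x
  proof -
    have "cmod (c k x) = ?t x * cmod (g k x / complex_of_real (?m (g k x)))"
      unfolding c_def norm_mult[of "complex_of_real (?t x)"] norm_of_real
      by (rule arg_cong2[where f="(*)", OF abs_of_nonneg refl]) simp
    also have "\<dots> \<le> indicator {- real n - 1..real n + 1} x * real n"
      by (rule mult_mono[OF _ clip]) (auto split: split_indicator)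
    finally show ?thesis by (simp only: mult.commute)
  qed
  have "(\<lambda>k. l2norm lborel (\<lambda>x. h x - c k x)) \<longlonglongrightarrow> 0"
  proof (rule l2norm_dominated_convergence[where w="\<lambda>x. 2 * ?W x"])
    have "(\<lambda>x. (2 * ?W x)\<^sup>2) = (\<lambda>x. indicator {- real n - 1..real n + 1} x *\<^sub>R (4 * (real n)\<^sup>2))"
      by (auto simp: fun_eq_iff power_mult_distrib split: split_indicator)
    then show "integrable lborel (\<lambda>x. (2 * ?W x)\<^sup>2)" by simp
    have "AE x in lebesgue. x \<notin> Z"
      using Z by (intro AE_not_in) (simp add: negligible_iff_null_sets)
    then have "AE x in lborel. x \<notin> Z" by (simp add: AE_completion_iff)
    then show "AE x in lborel. (\<lambda>k. h x - c k x) \<longlonglongrightarrow> 0"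
    proof eventually_elim
      fix x assume "x \<notin> Z"
      have "(\<lambda>k. h x - c k x) \<longlonglongrightarrow> h x - complex_of_real (?t x) * (h x / complex_of_real (?m (h x)))"
        unfolding c_def by (intro tendsto_intros lim \<open>x \<notin> Z\<close>) (use n in auto)
      also have "complex_of_real (?t x) * (h x / complex_of_real (?m (h x))) = h x"
      proof (cases "\<bar>x\<bar> > real n")
        case False
        then have "?t x = 1" by auto
        moreover have "?m (h x) = 1" using bdd[of x] n by (auto simp: max_def divide_le_eq)
        ultimately show ?thesis by simp
      qed (simp add: supp)
      finally show "(\<lambda>k. h x - c k x) \<longlonglongrightarrow> 0" by simp
    qed
    show "AE x in lborel. cmod (h x - c k x) \<le> 2 * ?W x" for k
    proof (rule AE_I2)
      fix x
      have "cmod (h x) \<le> ?W x"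
        using bdd[of x] supp[of x] by (cases "\<bar>x\<bar> > real n") (auto split: split_indicator)
      then show "cmod (h x - c k x) \<le> 2 * ?W x"
        using c_le[of k x] norm_triangle_ineq4[of "h x" "c k x"] by linarith
    qed
  qed measurable
  from order_tendstoD(2)[OF this e] obtain k where "l2norm lborel (\<lambda>x. h x - c k x) < e"
    by (auto simp: eventually_sequentially)
  with that[of "c k"] cont c_le show ?thesis by blast
qed

text \<open>One inequality is \<open>plancherel_le\<close>. Applied to differences it also makes the
  transform Lipschitz in norm, so the reverse inequality passes from continuous functions of compact
  support to \<open>f\<close>.\<close>

lemma plancherel:
  assumes f: "integrable lborel f" and f2: "square_integrable lborel f"
  shows "(l2norm lborel (ft f))\<^sup>2 = 2 * pi * (l2norm lborel f)\<^sup>2"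
proof -
  have sq: "l2norm lborel (ft g) \<le> sqrt (2 * pi) * l2norm lborel g"
    if "integrable lborel g" "square_integrable lborel g" for g
    using real_sqrt_le_mono[OF plancherel_le(2)[OF that]] by (simp add: real_sqrt_mult)
  have "sqrt (2 * pi) * l2norm lborel f \<le> l2norm lborel (ft f)"
  proof (rule field_le_epsilon)
    fix e :: real assume e: "e > 0"
    \<comment> \<open>The approximation error 2 d enters twice, once for \<open>f\<close> and once
      for its transform, each time multiplied by sqrt (2 pi).\<close>
    define d where "d = e / (4 * sqrt (2 * pi))"
    have d: "d > 0" using e by (simp add: d_def)
    obtain n :: nat and h where n: "n > 0" and h: "h \<in> borel_measurable borel"
      "\<And>x. cmod (h x) \<le> real n" "\<And>x. \<bar>x\<bar> > real n \<Longrightarrow> h x = 0"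
      and fh: "square_integrable lborel (\<lambda>x. f x - h x)" "l2norm lborel (\<lambda>x. f x - h x) < d"
      using l2_approx_bounded_support[OF f2 d] by blast
    obtain c where c: "continuous_on UNIV c"
      and c_le: "\<And>x. cmod (c x) \<le> real n * indicator {- real n - 1..real n + 1} x"
      and hc: "l2norm lborel (\<lambda>x. h x - c x) < d"
      using l2_approx_continuous_of_bounded_support[OF n h d] by blast
    have [measurable]: "c \<in> borel_measurable borel" using c by (rule borel_measurable_continuous_onI)
    have cn: "cmod (c x) \<le> real n" for x
      using c_le[of x] by (rule order_trans) (auto split: split_indicator)
    have ci: "integrable lborel c"
    proof (rule Bochner_Integration.integrable_bound[where f="\<lambda>x. indicator {- real n - 1..real n + 1} x *\<^sub>R real n"])
      show "AE x in lborel. norm (c x) \<le> norm (indicator {- real n - 1..real n + 1} x *\<^sub>R real n)"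
        using order_trans[OF c_le abs_ge_self] by (simp add: mult.commute)
    qed auto
    have "integrable lborel (\<lambda>x. (cmod (c x))\<^sup>2)"
    proof (rule Bochner_Integration.integrable_bound[where f="\<lambda>x. real n * cmod (c x)"])
      show "AE x in lborel. norm ((cmod (c x))\<^sup>2) \<le> norm (real n * cmod (c x))"
        by (auto simp: power2_eq_square intro!: mult_right_mono cn)
    qed (use ci in auto)
    then have c2: "square_integrable lborel c" by (simp add: square_integrable_def)
    note fc = square_integrable_diff[OF f2 c2]
    have "f x - c x = (f x - h x) + (h x - c x)" for x by simp
    moreover have "square_integrable lborel (\<lambda>x. h x - c x)"
      using square_integrable_diff(1)[OF fc(1) fh(1)] by simp
    ultimately have fcd: "l2norm lborel (\<lambda>x. f x - c x) \<le> d + d"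
      using square_integrable_add(2)[OF fh(1), of "\<lambda>x. h x - c x"] fh(2) hc by simp
    have fci: "integrable lborel (\<lambda>x. f x - c x)" using f ci by simp
    have "l2norm lborel (ft c) = sqrt (2 * pi) * l2norm lborel c"
      using arg_cong[OF plancherel_continuous[OF ci c2 c cn], of sqrt] by (simp add: real_sqrt_mult)
    moreover have "l2norm lborel (ft c) \<le> l2norm lborel (ft f) + l2norm lborel (ft (\<lambda>x. f x - c x))"
    proof -
      have "l2norm lborel (ft (\<lambda>x. f x - c x)) = l2norm lborel (\<lambda>k. ft c k - ft f k)"
        unfolding l2norm_def ft_diff[OF f ci] by (simp add: norm_minus_commute)
      then show ?thesis
        using square_integrable_diff(3)[OF plancherel_le(1)[OF ci c2] plancherel_le(1)[OF f f2]] by simp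
    qed
    moreover have "l2norm lborel (ft (\<lambda>x. f x - c x)) \<le> sqrt (2 * pi) * (2 * d)"
      by (rule order_trans[OF sq[OF fci fc(1)]], rule mult_left_mono) (use fcd in auto)
    moreover have "sqrt (2 * pi) * l2norm lborel f \<le> sqrt (2 * pi) * (l2norm lborel c + 2 * d)"
      using fc(3) fcd by (intro mult_left_mono) auto
    moreover have "sqrt (2 * pi) * (4 * d) = e" by (simp add: d_def)
    ultimately show "sqrt (2 * pi) * l2norm lborel f \<le> l2norm lborel (ft f) + e"
      by (simp add: algebra_simps)
  qed
  with sq[OF f f2] have "l2norm lborel (ft f) = sqrt (2 * pi) * l2norm lborel f" by simp
  then show ?thesis by (simp add: power_mult_distrib)
qed

section \<open>The short-time Fourier transform with Gaussian window\<close>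

text \<open>The window is the Gaussian weight of \<open>hermite_space\<close> at the same scale,
  recentred at \<open>q\<close>; this match later turns orthogonality into vanishing Taylor
  coefficients. It is not normalised: its squared norm sqrt pi / b accounts for the recurring
  constant 2 pi (sqrt pi / b). For fixed \<open>q\<close> this is an ordinary transform in the last
  argument, open to Plancherel.\<close>

definition stft :: "real \<Rightarrow> (real \<Rightarrow> complex) \<Rightarrow> real \<Rightarrow> real \<Rightarrow> complex" where
  "stft b f q = ft (\<lambda>x. f x * complex_of_real (exp (- (b\<^sup>2 * (x - q)\<^sup>2) / 2)))"

lemma gaussian_square_integrable:
  assumes "b > 0"
  shows "square_integrable lborel (\<lambda>x. complex_of_real (exp (- (b\<^sup>2 * (x - q)\<^sup>2) / 2)))"
    and "l2norm lborel (\<lambda>x. complex_of_real (exp (- (b\<^sup>2 * (x - q)\<^sup>2) / 2))) = sqrt (sqrt pi / b)"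
proof -
  have "(exp (- (b\<^sup>2 * (x - q)\<^sup>2) / 2))\<^sup>2 = exp (- (b\<^sup>2 * (x - q)\<^sup>2))" for x :: real
    by (simp flip: exp_of_nat_mult add: exp_double[symmetric])
  then show "square_integrable lborel (\<lambda>x. complex_of_real (exp (- (b\<^sup>2 * (x - q)\<^sup>2) / 2)))"
    and "l2norm lborel (\<lambda>x. complex_of_real (exp (- (b\<^sup>2 * (x - q)\<^sup>2) / 2))) = sqrt (sqrt pi / b)"
    using gaussian_integral[OF assms, of q] by (simp_all add: square_integrable_def l2norm_def)
qed

text \<open>What Plancherel asks for: the window is square-integrable, so Cauchy-Schwarz gives
  integrability, and it is at most 1, so square-integrability is kept.\<close>

lemma windowed_integrable:
  assumes f: "square_integrable lborel f" and b: "b > 0"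
  shows "integrable lborel (\<lambda>x. f x * complex_of_real (exp (- (b\<^sup>2 * (x - q)\<^sup>2) / 2)))"
    and "square_integrable lborel (\<lambda>x. f x * complex_of_real (exp (- (b\<^sup>2 * (x - q)\<^sup>2) / 2)))"
proof -
  have [measurable]: "f \<in> borel_measurable borel" using f by (auto simp: square_integrable_def)
  show "integrable lborel (\<lambda>x. f x * complex_of_real (exp (- (b\<^sup>2 * (x - q)\<^sup>2) / 2)))"
    by (rule square_integrable_mult_integrable(1)[OF f gaussian_square_integrable(1)[OF b]])
  show "square_integrable lborel (\<lambda>x. f x * complex_of_real (exp (- (b\<^sup>2 * (x - q)\<^sup>2) / 2)))"
    by (rule square_integrable_mono(1)[OF f]) (auto simp: norm_mult intro!: mult_left_le)
qed

lemma measurable_stft [measurable]: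
  assumes [measurable]: "f \<in> borel_measurable borel"
  shows "(\<lambda>(q, p). stft b f q p) \<in> borel_measurable (lborel \<Otimes>\<^sub>M lborel)"
  unfolding stft_def ft_def by measurable

lemma stft_diff:
  assumes "square_integrable lborel f" "square_integrable lborel g" "b > 0"
  shows "stft b (\<lambda>x. f x - g x) q p = stft b f q p - stft b g q p"
  using ft_diff[OF windowed_integrable(1)[OF assms(1,3), of q] windowed_integrable(1)[OF assms(2,3), of q]]
  by (simp add: stft_def algebra_simps)

text \<open>Plancherel in p at each fixed q, then Tonelli in q and x. The set \<open>S\<close>
  restricts positions only, so the p-integral stays complete; the isometry and the spatial tail are
  both instances.\<close>

lemma stft_nn_integral:
  assumes f: "square_integrable lborel f" and b: "b > 0" and [measurable]: "S \<in> sets borel"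
  shows "(\<integral>\<^sup>+z. indicator S (fst z) * ennreal ((cmod (stft b f (fst z) (snd z)))\<^sup>2) \<partial>(lborel \<Otimes>\<^sub>M lborel))
    = (\<integral>\<^sup>+x. ennreal (2 * pi * (cmod (f x))\<^sup>2) * (\<integral>\<^sup>+q. indicator S q * ennreal (exp (- (b\<^sup>2 * (q - x)\<^sup>2))) \<partial>lborel) \<partial>lborel)"
proof -
  have [measurable]: "f \<in> borel_measurable borel" using f by (auto simp: square_integrable_def)
  have st: "(\<lambda>z. stft b f (fst z) (snd z)) \<in> borel_measurable (lborel \<Otimes>\<^sub>M lborel)"
    using measurable_stft[of f b] by (simp add: case_prod_beta')
  note [measurable] = st
  have "(\<integral>\<^sup>+z. indicator S (fst z) * ennreal ((cmod (stft b f (fst z) (snd z)))\<^sup>2) \<partial>(lborel \<Otimes>\<^sub>M lborel))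
     = (\<integral>\<^sup>+q. (\<integral>\<^sup>+p. indicator S q * ennreal ((cmod (stft b f q p))\<^sup>2) \<partial>lborel) \<partial>lborel)"
    by (subst lborel.nn_integral_fst[symmetric]) simp_all
  also have "\<dots> = (\<integral>\<^sup>+q. (\<integral>\<^sup>+x. ennreal (2 * pi * (cmod (f x))\<^sup>2) * (indicator S q * ennreal (exp (- (b\<^sup>2 * (q - x)\<^sup>2)))) \<partial>lborel) \<partial>lborel)"
  proof (rule nn_integral_cong)
    fix q
    let ?g = "\<lambda>x. f x * complex_of_real (exp (- (b\<^sup>2 * (x - q)\<^sup>2) / 2))"
    note w = windowed_integrable[OF f b, of q]
    have "(\<integral>\<^sup>+p. indicator S q * ennreal ((cmod (stft b f q p))\<^sup>2) \<partial>lborel)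
       = indicator S q * (\<integral>\<^sup>+p. ennreal ((cmod (ft ?g p))\<^sup>2) \<partial>lborel)"
      unfolding stft_def by (rule nn_integral_cmult) measurable
    also have "(\<integral>\<^sup>+p. ennreal ((cmod (ft ?g p))\<^sup>2) \<partial>lborel) = ennreal (2 * pi) * (\<integral>\<^sup>+x. ennreal ((cmod (?g x))\<^sup>2) \<partial>lborel)"
      unfolding nn_integral_square_integrable[OF plancherel_le(1)[OF w]] plancherel[OF w]
        nn_integral_square_integrable[OF w(2)] by (simp add: ennreal_mult)
    also have "\<dots> = (\<integral>\<^sup>+x. ennreal (2 * pi) * ennreal ((cmod (?g x))\<^sup>2) \<partial>lborel)"
      by (rule nn_integral_cmult[symmetric]) measurable
    also have "indicator S q * \<dots> = (\<integral>\<^sup>+x. indicator S q * (ennreal (2 * pi) * ennreal ((cmod (?g x))\<^sup>2)) \<partial>lborel)"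
      by (rule nn_integral_cmult[symmetric]) measurable
    also have "\<dots> = (\<integral>\<^sup>+x. ennreal (2 * pi * (cmod (f x))\<^sup>2) * (indicator S q * ennreal (exp (- (b\<^sup>2 * (q - x)\<^sup>2)))) \<partial>lborel)"
    proof (rule nn_integral_cong)
      fix x
      have "(cmod (?g x))\<^sup>2 = (cmod (f x))\<^sup>2 * exp (- (b\<^sup>2 * (q - x)\<^sup>2))"
        by (simp add: norm_mult power_mult_distrib power2_commute[of q x] flip: exp_double)
      then show "indicator S q * (ennreal (2 * pi) * ennreal ((cmod (?g x))\<^sup>2))
        = ennreal (2 * pi * (cmod (f x))\<^sup>2) * (indicator S q * ennreal (exp (- (b\<^sup>2 * (q - x)\<^sup>2))))"
        by (simp add: ennreal_mult mult_ac)
    qed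
    finally show "(\<integral>\<^sup>+p. indicator S q * ennreal ((cmod (stft b f q p))\<^sup>2) \<partial>lborel) = \<dots>" .
  qed
  also have "\<dots> = (\<integral>\<^sup>+x. (\<integral>\<^sup>+q. ennreal (2 * pi * (cmod (f x))\<^sup>2) * (indicator S q * ennreal (exp (- (b\<^sup>2 * (q - x)\<^sup>2)))) \<partial>lborel) \<partial>lborel)"
    by (rule lborel_pair.Fubini') measurable
  also have "\<dots> = (\<integral>\<^sup>+x. ennreal (2 * pi * (cmod (f x))\<^sup>2) * (\<integral>\<^sup>+q. indicator S q * ennreal (exp (- (b\<^sup>2 * (q - x)\<^sup>2))) \<partial>lborel) \<partial>lborel)"
    by (intro nn_integral_cong nn_integral_cmult) measurable
  finally show ?thesis .
qed

lemma stft_isometry: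
  assumes f: "square_integrable lborel f" and b: "b > 0"
  shows "square_integrable (lborel \<Otimes>\<^sub>M lborel) (\<lambda>z. stft b f (fst z) (snd z))"
    and "(l2norm (lborel \<Otimes>\<^sub>M lborel) (\<lambda>z. stft b f (fst z) (snd z)))\<^sup>2 = 2 * pi * (sqrt pi / b) * (l2norm lborel f)\<^sup>2"
proof -
  have [measurable]: "f \<in> borel_measurable borel" using f by (auto simp: square_integrable_def)
  have m: "(\<lambda>z. stft b f (fst z) (snd z)) \<in> borel_measurable (lborel \<Otimes>\<^sub>M lborel)"
    using measurable_stft[of f b] by (simp add: case_prod_beta')
  have g: "(\<integral>\<^sup>+q. ennreal (exp (- (b\<^sup>2 * (q - x)\<^sup>2))) \<partial>lborel) = ennreal (sqrt pi / b)" for x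
    using gaussian_integral[OF b, of x] by (simp add: nn_integral_eq_integral)
  have "(\<integral>\<^sup>+z. ennreal ((cmod (stft b f (fst z) (snd z)))\<^sup>2) \<partial>(lborel \<Otimes>\<^sub>M lborel))
    = (\<integral>\<^sup>+x. ennreal ((cmod (f x))\<^sup>2) * ennreal (2 * pi * (sqrt pi / b)) \<partial>lborel)"
    using stft_nn_integral[OF f b, of UNIV] b by (simp add: g ennreal_mult[symmetric] mult_ac)
  also have "\<dots> = ennreal ((l2norm lborel f)\<^sup>2) * ennreal (2 * pi * (sqrt pi / b))"
    unfolding nn_integral_square_integrable[OF f, symmetric] by (rule nn_integral_multc) measurable
  also have "\<dots> = ennreal (2 * pi * (sqrt pi / b) * (l2norm lborel f)\<^sup>2)"
    using b by (simp add: ennreal_mult[symmetric] mult_ac)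
  finally have eq: "(\<integral>\<^sup>+z. ennreal ((cmod (stft b f (fst z) (snd z)))\<^sup>2) \<partial>(lborel \<Otimes>\<^sub>M lborel))
    = ennreal (2 * pi * (sqrt pi / b) * (l2norm lborel f)\<^sup>2)" .
  show si: "square_integrable (lborel \<Otimes>\<^sub>M lborel) (\<lambda>z. stft b f (fst z) (snd z))"
    by (rule square_integrableI_nn_integral(1)[OF m eq[THEN eq_refl]]) (use b in auto)
  show "(l2norm (lborel \<Otimes>\<^sub>M lborel) (\<lambda>z. stft b f (fst z) (snd z)))\<^sup>2 = 2 * pi * (sqrt pi / b) * (l2norm lborel f)\<^sup>2"
    using eq unfolding nn_integral_square_integrable[OF si] using b by (subst (asm) ennreal_inj) auto
qed

text \<open>A point with |x| <= T lies at distance more than T from every q with |q| > 2 T, so the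
  squared window has a factor exp (- b^2 T^2) to spare there; the remaining x make up the tail of
  \<open>f\<close>. The coefficient 2 counts the half-lines q > 2 T and q < - 2 T.\<close>

lemma stft_tail:
  assumes f: "square_integrable lborel f" and b: "b > 0" and T: "T \<ge> 0"
  shows "(\<integral>\<^sup>+z. indicator {q. \<bar>q\<bar> > 2 * T} (fst z) * ennreal ((cmod (stft b f (fst z) (snd z)))\<^sup>2) \<partial>(lborel \<Otimes>\<^sub>M lborel))
    \<le> ennreal (2 * pi * (sqrt pi / b) *
        ((l2norm lborel (\<lambda>x. indicator {x. \<bar>x\<bar> > T} x * f x))\<^sup>2 + 2 * exp (- (b\<^sup>2 * T\<^sup>2)) * (l2norm lborel f)\<^sup>2))"
proof -
  have [measurable]: "f \<in> borel_measurable borel" using f by (auto simp: square_integrable_def)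
  let ?K = "sqrt pi / b" and ?E = "exp (- (b\<^sup>2 * T\<^sup>2))"
  have K: "?K \<ge> 0" using b by simp
  have g: "(\<integral>\<^sup>+q. ennreal (exp (- (b\<^sup>2 * (q - x)\<^sup>2))) \<partial>lborel) = ennreal ?K" for x
    using gaussian_integral[OF b, of x] by (simp add: nn_integral_eq_integral)
  have pt: "indicator {q. \<bar>q\<bar> > 2 * T} q * exp (- (b\<^sup>2 * (q - x)\<^sup>2))
     \<le> indicator {x. \<bar>x\<bar> > T} x * exp (- (b\<^sup>2 * (q - x)\<^sup>2))
       + (?E * exp (- (b\<^sup>2 * (q - 2 * T)\<^sup>2)) + ?E * exp (- (b\<^sup>2 * (q - (- 2 * T))\<^sup>2)))" for q x :: real
  proof (cases "\<bar>x\<bar> \<le> T \<and> \<bar>q\<bar> > 2 * T")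
    case True
    show ?thesis
    proof (cases "q > 0")
      case True
      with \<open>\<bar>x\<bar> \<le> T \<and> \<bar>q\<bar> > 2 * T\<close> T have "(q - x)\<^sup>2 \<ge> ((q - 2 * T) + T)\<^sup>2" "0 \<le> (q - 2 * T) * T"
        by (auto intro!: power_mono)
      \<comment> \<open>Expanding ((q - 2 T) + T)^2 and dropping the nonnegative cross term leaves a
        constant for the small factor and a Gaussian that is still integrable in q.\<close>
      then have "T\<^sup>2 + (q - 2 * T)\<^sup>2 \<le> (q - x)\<^sup>2" by (simp add: power2_eq_square algebra_simps)
      then have "b\<^sup>2 * (T\<^sup>2 + (q - 2 * T)\<^sup>2) \<le> b\<^sup>2 * (q - x)\<^sup>2" by (intro mult_left_mono) auto
      then have "exp (- (b\<^sup>2 * (q - x)\<^sup>2)) \<le> ?E * exp (- (b\<^sup>2 * (q - 2 * T)\<^sup>2))"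
        by (simp add: exp_add[symmetric] algebra_simps)
      then show ?thesis using \<open>\<bar>x\<bar> \<le> T \<and> \<bar>q\<bar> > 2 * T\<close> by (simp add: add_increasing2)
    next
      case False
      with \<open>\<bar>x\<bar> \<le> T \<and> \<bar>q\<bar> > 2 * T\<close> T have "(x - q)\<^sup>2 \<ge> ((- q - 2 * T) + T)\<^sup>2" "0 \<le> (- q - 2 * T) * T"
        by (auto intro!: power_mono)
      then have "T\<^sup>2 + (- q - 2 * T)\<^sup>2 \<le> (x - q)\<^sup>2" by (simp add: power2_eq_square algebra_simps)
      then have "b\<^sup>2 * (T\<^sup>2 + (q - (- 2 * T))\<^sup>2) \<le> b\<^sup>2 * (q - x)\<^sup>2"
        by (intro mult_left_mono) (auto simp: power2_eq_square algebra_simps)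
      then have "exp (- (b\<^sup>2 * (q - x)\<^sup>2)) \<le> ?E * exp (- (b\<^sup>2 * (q - (- 2 * T))\<^sup>2))"
        by (simp add: exp_add[symmetric] algebra_simps)
      then show ?thesis using \<open>\<bar>x\<bar> \<le> T \<and> \<bar>q\<bar> > 2 * T\<close> by (simp add: add_increasing)
    qed
  qed (auto split: split_indicator simp: add_increasing2)
  have q_int: "(\<integral>\<^sup>+q. indicator {q. \<bar>q\<bar> > 2 * T} q * ennreal (exp (- (b\<^sup>2 * (q - x)\<^sup>2))) \<partial>lborel)
    \<le> ennreal (?K * (indicator {x. \<bar>x\<bar> > T} x + 2 * ?E))" for x
  proof -
    have "(\<integral>\<^sup>+q. indicator {q. \<bar>q\<bar> > 2 * T} q * ennreal (exp (- (b\<^sup>2 * (q - x)\<^sup>2))) \<partial>lborel)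
      \<le> (\<integral>\<^sup>+q. ennreal (indicator {x. \<bar>x\<bar> > T} x) * ennreal (exp (- (b\<^sup>2 * (q - x)\<^sup>2)))
       + (ennreal ?E * ennreal (exp (- (b\<^sup>2 * (q - 2 * T)\<^sup>2))) + ennreal ?E * ennreal (exp (- (b\<^sup>2 * (q - (- 2 * T))\<^sup>2)))) \<partial>lborel)"
      using pt[of _ x]
      by (intro nn_integral_mono) (simp add: ennreal_indicator[symmetric] ennreal_mult[symmetric] ennreal_plus[symmetric] del: ennreal_plus minus_mult_left)
    also have "\<dots> = ennreal (indicator {x. \<bar>x\<bar> > T} x) * ennreal ?K + (ennreal ?E * ennreal ?K + ennreal ?E * ennreal ?K)"
      by (subst nn_integral_add nn_integral_cmult; (measurable)?)+ (simp only: g)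
    also have "\<dots> = ennreal (?K * (indicator {x. \<bar>x\<bar> > T} x + 2 * ?E))"
      using K b by (simp add: ennreal_mult[symmetric] ennreal_plus[symmetric] algebra_simps del: ennreal_plus)
    finally show ?thesis .
  qed
  have fT: "square_integrable lborel (\<lambda>x. indicator {x. \<bar>x\<bar> > T} x * f x)"
    by (rule square_integrable_indicator(1)[OF f]) measurable
  have "(\<integral>\<^sup>+z. indicator {q. \<bar>q\<bar> > 2 * T} (fst z) * ennreal ((cmod (stft b f (fst z) (snd z)))\<^sup>2) \<partial>(lborel \<Otimes>\<^sub>M lborel))
    = (\<integral>\<^sup>+x. ennreal (2 * pi * (cmod (f x))\<^sup>2) * (\<integral>\<^sup>+q. indicator {q. \<bar>q\<bar> > 2 * T} q * ennreal (exp (- (b\<^sup>2 * (q - x)\<^sup>2))) \<partial>lborel) \<partial>lborel)"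
    by (rule stft_nn_integral[OF f b]) measurable
  also have "\<dots> \<le> (\<integral>\<^sup>+x. ennreal (2 * pi * (cmod (f x))\<^sup>2) * ennreal (?K * (indicator {x. \<bar>x\<bar> > T} x + 2 * ?E)) \<partial>lborel)"
    by (intro nn_integral_mono mult_left_mono q_int) auto
  also have "\<dots> = (\<integral>\<^sup>+x. ennreal (2 * pi * ?K) * (ennreal ((cmod (indicator {x. \<bar>x\<bar> > T} x * f x))\<^sup>2) + ennreal (2 * ?E) * ennreal ((cmod (f x))\<^sup>2)) \<partial>lborel)"
  proof (rule nn_integral_cong)
    fix x
    have "2 * pi * (cmod (f x))\<^sup>2 * (?K * (indicator {x. \<bar>x\<bar> > T} x + 2 * ?E))
      = 2 * pi * ?K * ((cmod (indicator {x. \<bar>x\<bar> > T} x * f x))\<^sup>2 + 2 * ?E * (cmod (f x))\<^sup>2)"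
      by (cases "\<bar>x\<bar> > T") (auto simp: field_simps)
    then show "ennreal (2 * pi * (cmod (f x))\<^sup>2) * ennreal (?K * (indicator {x. \<bar>x\<bar> > T} x + 2 * ?E))
      = ennreal (2 * pi * ?K) * (ennreal ((cmod (indicator {x. \<bar>x\<bar> > T} x * f x))\<^sup>2) + ennreal (2 * ?E) * ennreal ((cmod (f x))\<^sup>2))"
      using K by (simp only: ennreal_mult[symmetric] ennreal_plus[symmetric] zero_le_power2 exp_ge_zero pi_ge_zero
          mult_nonneg_nonneg add_nonneg_nonneg zero_le_numeral indicator_pos_le)
  qed
  also have "\<dots> = ennreal (2 * pi * ?K) * (ennreal ((l2norm lborel (\<lambda>x. indicator {x. \<bar>x\<bar> > T} x * f x))\<^sup>2) + ennreal (2 * ?E) * ennreal ((l2norm lborel f)\<^sup>2))"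
    unfolding nn_integral_square_integrable[OF f, symmetric] nn_integral_square_integrable[OF fT, symmetric]
    by (simp add: nn_integral_cmult nn_integral_add)
  also have "\<dots> = ennreal (2 * pi * ?K * ((l2norm lborel (\<lambda>x. indicator {x. \<bar>x\<bar> > T} x * f x))\<^sup>2 + 2 * ?E * (l2norm lborel f)\<^sup>2))"
    using K b by (simp add: ennreal_mult[symmetric] ennreal_plus[symmetric] del: ennreal_plus)
  finally show ?thesis .
qed

section \<open>The L2 Fourier transform and the frequency tail\<close>

lemma fourier_trunc_eq_ft:
  "fourier_trunc u R k = complex_of_real (1 / sqrt (2 * pi)) * ft (\<lambda>x. indicator {-R..R} x * u x) k"
  by (simp add: fourier_trunc_def ft_def)

lemma truncation_integrable:
  fixes u :: "real \<Rightarrow> complex"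
  assumes u: "square_integrable lborel u"
  shows "square_integrable lborel (\<lambda>x. indicator {-R..R} x * u x)"
    and "l2norm lborel (\<lambda>x. indicator {-R..R} x * u x) \<le> l2norm lborel u"
    and "integrable lborel (\<lambda>x. indicator {-R..R} x * u x)"
proof -
  show "square_integrable lborel (\<lambda>x. indicator {-R..R} x * u x)"
    by (rule square_integrable_indicator(1)[OF u]) simp
  show "l2norm lborel (\<lambda>x. indicator {-R..R} x * u x) \<le> l2norm lborel u"
    by (rule square_integrable_indicator(2)[OF u]) simp
  have "(\<lambda>x. (cmod (indicator {-R..R} x))\<^sup>2) = (\<lambda>x. indicator {-R..R} x *\<^sub>R (1::real))"
    by (auto simp: fun_eq_iff split: split_indicator)
  then have "square_integrable lborel (\<lambda>x::real. indicator {-R..R} x :: complex)"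
    by (auto simp: square_integrable_def emeasure_lborel_Icc_eq intro!: integrable_real_indicator)
  from square_integrable_mult_integrable(1)[OF this u]
  show "integrable lborel (\<lambda>x. indicator {-R..R} x * u x)" .
qed

text \<open>\<open>g\<close> is known only as a norm limit of transforms of truncations; by
  Plancherel each of them has norm at most that of \<open>u\<close>, and letting R tend to infinity
  removes the error term.\<close>

lemma L2_fourier_norm_le:
  assumes u: "square_integrable lborel u" and g: "is_L2_fourier u g"
  shows "l2norm lborel g \<le> l2norm lborel u"
proof -
  have g2: "square_integrable lborel g" and
    lim: "((\<lambda>R. l2norm lborel (\<lambda>k. g k - fourier_trunc u R k)) \<longlongrightarrow> 0) at_top"
    using g by (auto simp: is_L2_fourier_def sq_int_eq_square_integrable L2_norm_eq_l2norm)
  have le: "l2norm lborel g \<le> l2norm lborel u + l2norm lborel (\<lambda>k. g k - fourier_trunc u R k)" for R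
  proof -
    note uR = truncation_integrable[OF u, of R]
    have t2: "square_integrable lborel (fourier_trunc u R)"
      unfolding fourier_trunc_eq_ft[abs_def] by (rule square_integrable_cmult[OF plancherel_le(1)[OF uR(3,1)]])
    have "(l2norm lborel (fourier_trunc u R))\<^sup>2 = (l2norm lborel (\<lambda>x. indicator {-R..R} x * u x))\<^sup>2"
      unfolding fourier_trunc_eq_ft[abs_def] l2norm_cmult power_mult_distrib plancherel[OF uR(3,1)]
      by (simp add: norm_divide power_divide)
    then have "l2norm lborel (fourier_trunc u R) \<le> l2norm lborel u"
      using uR(2) by simp
    then show ?thesis using square_integrable_diff(3)[OF g2 t2] by simp
  qed
  have "((\<lambda>R. l2norm lborel u + l2norm lborel (\<lambda>k. g k - fourier_trunc u R k)) \<longlongrightarrow> l2norm lborel u) at_top"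
    using tendsto_add[OF tendsto_const lim, of "l2norm lborel u"] by simp
  then show ?thesis
    by (rule tendsto_lowerbound) (auto simp: le)
qed

text \<open>The Gaussian window is, up to a factor, its own Fourier transform, so passing to the Fourier side
  rotates the phase plane by a right angle.\<close>

lemma stft_fourier:
  assumes u: "square_integrable lborel u" and g: "is_L2_fourier u g" and b: "b > 0"
  shows "stft b u q p = complex_of_real (1 / b) * exp (- \<i> * complex_of_real (p * q)) * stft (1 / b) g p (- q)"
proof -
  have g2: "square_integrable lborel g" and
    lim: "((\<lambda>R. l2norm lborel (\<lambda>k. g k - fourier_trunc u R k)) \<longlongrightarrow> 0) at_top"
    using g by (auto simp: is_L2_fourier_def sq_int_eq_square_integrable L2_norm_eq_l2norm)
  have [measurable]: "u \<in> borel_measurable borel" using u by (auto simp: square_integrable_def)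
  have ib: "1 / b > 0" using b by simp
  let ?w = "\<lambda>x. complex_of_real (exp (- (b\<^sup>2 * (x - q)\<^sup>2) / 2))"
  \<comment> \<open>Chosen so that its transform is, up to a constant, the kernel of
    \<open>stft b u q p\<close>; the multiplication formula then moves the transform from the kernel
    onto the truncations of \<open>u\<close>.\<close>
  define \<phi> where "\<phi> k = complex_of_real (exp (- ((1 / b)\<^sup>2 * (k - p)\<^sup>2) / 2)) * exp (- \<i> * complex_of_real ((- q) * k))" for k
  have [measurable]: "\<phi> \<in> borel_measurable borel" unfolding \<phi>_def[abs_def] by measurable
  have \<phi>2: "square_integrable lborel \<phi>"
    by (rule square_integrable_mono(1)[OF gaussian_square_integrable(1)[OF ib, of p]])
       (auto simp: \<phi>_def norm_mult)
  have \<phi>1: "integrable lborel \<phi>"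
    unfolding \<phi>_def using gaussian_half_integral(1)[OF ib, of p]
    by (intro integrable_mult_exp_ii) simp
  have ft\<phi>: "ft \<phi> x = complex_of_real (sqrt (2 * pi) * b) * exp (\<i> * complex_of_real (p * q)) * (?w x * exp (- \<i> * complex_of_real (p * x)))" for x
  proof -
    have "ft \<phi> x = ft (\<lambda>k. complex_of_real (exp (- ((1 / b)\<^sup>2 * (k - p)\<^sup>2) / 2))) (x - q)"
      unfolding ft_def \<phi>_def
      by (rule Bochner_Integration.integral_cong) (auto simp: exp_add[symmetric] algebra_simps)
    also have "\<dots> = complex_of_real (sqrt (2 * pi) * b * exp (- (b\<^sup>2 * (x - q)\<^sup>2) / 2)) * exp (- \<i> * complex_of_real ((x - q) * p))"
      by (subst ft_gaussian[OF ib]) (simp add: power_divide mult.commute)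
    also have "exp (- \<i> * complex_of_real ((x - q) * p)) = exp (\<i> * complex_of_real (p * q)) * exp (- \<i> * complex_of_real (p * x))"
      by (auto simp: exp_add[symmetric] algebra_simps)
    finally show ?thesis by simp
  qed
  have trunc: "(\<integral>x. indicator {-R..R} x * u x * (?w x * exp (- \<i> * complex_of_real (p * x))) \<partial>lborel)
      = complex_of_real (1 / b) * exp (- \<i> * complex_of_real (p * q)) * (\<integral>k. fourier_trunc u R k * \<phi> k \<partial>lborel)" for R
  proof -
    let ?uR = "\<lambda>x. indicator {-R..R} x * u x"
    note uR = truncation_integrable[OF u, of R]
    let ?I = "\<integral>x. ?uR x * (?w x * exp (- \<i> * complex_of_real (p * x))) \<partial>lborel"
    have "(\<integral>k. fourier_trunc u R k * \<phi> k \<partial>lborel) = complex_of_real (1 / sqrt (2 * pi)) * (\<integral>k. ft ?uR k * \<phi> k \<partial>lborel)"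
      unfolding fourier_trunc_eq_ft mult.assoc by (rule integral_mult_right_zero)
    also have "(\<integral>k. ft ?uR k * \<phi> k \<partial>lborel) = (\<integral>x. ?uR x * ft \<phi> x \<partial>lborel)"
      by (rule ft_multiplication_formula[OF uR(3) \<phi>1])
    also have "\<dots> = (\<integral>x. (complex_of_real (sqrt (2 * pi) * b) * exp (\<i> * complex_of_real (p * q))) * (?uR x * (?w x * exp (- \<i> * complex_of_real (p * x)))) \<partial>lborel)"
      unfolding ft\<phi> by (rule Bochner_Integration.integral_cong) (simp_all only: mult_ac)
    also have "\<dots> = complex_of_real (sqrt (2 * pi) * b) * exp (\<i> * complex_of_real (p * q)) * ?I"
      by (rule integral_mult_right_zero)
    finally have "(\<integral>k. fourier_trunc u R k * \<phi> k \<partial>lborel) = complex_of_real b * exp (\<i> * complex_of_real (p * q)) * ?I"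
      by simp
    then have "complex_of_real (1 / b) * exp (- \<i> * complex_of_real (p * q)) * (\<integral>k. fourier_trunc u R k * \<phi> k \<partial>lborel)
       = (exp (- \<i> * complex_of_real (p * q)) * exp (\<i> * complex_of_real (p * q))) * ?I"
      using b by simp
    also have "\<dots> = ?I" by (simp add: exp_add[symmetric])
    finally show ?thesis by simp
  qed
  \<comment> \<open>Both sides of the truncation identity now pass to the limit along integers R =
    n: the left by dominated convergence, a statement about sequences, the right because pairing
    with the fixed \<open>\<phi>\<close> is continuous in norm.\<close>
  have top: "filterlim (\<lambda>n. real n) at_top sequentially" by (rule filterlim_real_sequentially)
  have lim1: "(\<lambda>n. \<integral>x. indicator {-real n..real n} x * u x * (?w x * exp (- \<i> * complex_of_real (p * x))) \<partial>lborel)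
     \<longlonglongrightarrow> (\<integral>x. u x * (?w x * exp (- \<i> * complex_of_real (p * x))) \<partial>lborel)"
  proof (rule integral_dominated_convergence[where w="\<lambda>x. cmod (u x * ?w x)"])
    show "integrable lborel (\<lambda>x. cmod (u x * ?w x))"
      by (rule integrable_norm[OF windowed_integrable(1)[OF u b]])
    show "AE x in lborel. (\<lambda>n. indicator {-real n..real n} x * u x * (?w x * exp (- \<i> * complex_of_real (p * x))))
      \<longlonglongrightarrow> u x * (?w x * exp (- \<i> * complex_of_real (p * x)))"
    proof (rule AE_I2)
      fix x
      obtain m :: nat where "\<bar>x\<bar> \<le> real m" using real_arch_simple by blast
      then have "\<forall>\<^sub>F n in sequentially. indicator {-real n..real n} x * u x * (?w x * exp (- \<i> * complex_of_real (p * x)))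
         = u x * (?w x * exp (- \<i> * complex_of_real (p * x)))"
        by (auto simp: eventually_sequentially intro!: exI[of _ m] split: split_indicator)
      then show "(\<lambda>n. indicator {-real n..real n} x * u x * (?w x * exp (- \<i> * complex_of_real (p * x))))
        \<longlonglongrightarrow> u x * (?w x * exp (- \<i> * complex_of_real (p * x)))" by (rule tendsto_eventually)
    qed
    show "AE x in lborel. norm (indicator {-real n..real n} x * u x * (?w x * exp (- \<i> * complex_of_real (p * x)))) \<le> cmod (u x * ?w x)" for n
      by (auto simp: norm_mult split: split_indicator)
  qed measurable
  have "((\<lambda>R. (\<integral>k. g k * \<phi> k \<partial>lborel) - (\<integral>k. fourier_trunc u R k * \<phi> k \<partial>lborel)) \<longlongrightarrow> 0) at_top"
  proof (rule Lim_null_comparison)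
    show "\<forall>\<^sub>F R in at_top. norm ((\<integral>k. g k * \<phi> k \<partial>lborel) - (\<integral>k. fourier_trunc u R k * \<phi> k \<partial>lborel))
       \<le> l2norm lborel (\<lambda>k. g k - fourier_trunc u R k) * l2norm lborel \<phi>"
    proof (rule always_eventually, rule allI)
      fix R
      note uR = truncation_integrable[OF u, of R]
      have t2: "square_integrable lborel (fourier_trunc u R)"
        unfolding fourier_trunc_eq_ft[abs_def] by (rule square_integrable_cmult[OF plancherel_le(1)[OF uR(3,1)]])
      have "(\<integral>k. g k * \<phi> k \<partial>lborel) - (\<integral>k. fourier_trunc u R k * \<phi> k \<partial>lborel)
         = (\<integral>k. (g k - fourier_trunc u R k) * \<phi> k \<partial>lborel)"
        using square_integrable_mult_integrable(1)[OF g2 \<phi>2] square_integrable_mult_integrable(1)[OF t2 \<phi>2]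
        by (simp add: left_diff_distrib)
      then show "norm ((\<integral>k. g k * \<phi> k \<partial>lborel) - (\<integral>k. fourier_trunc u R k * \<phi> k \<partial>lborel))
       \<le> l2norm lborel (\<lambda>k. g k - fourier_trunc u R k) * l2norm lborel \<phi>"
        using square_integrable_mult_integrable(2)[OF square_integrable_diff(1)[OF g2 t2] \<phi>2] by simp
    qed
    show "((\<lambda>R. l2norm lborel (\<lambda>k. g k - fourier_trunc u R k) * l2norm lborel \<phi>) \<longlongrightarrow> 0) at_top"
      using tendsto_mult_right[OF lim, of "l2norm lborel \<phi>"] by simp
  qed
  from tendsto_diff[OF tendsto_const[of "\<integral>k. g k * \<phi> k \<partial>lborel"] this]
  have "((\<lambda>R. \<integral>k. fourier_trunc u R k * \<phi> k \<partial>lborel) \<longlongrightarrow> (\<integral>k. g k * \<phi> k \<partial>lborel)) at_top" by simp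
  from filterlim_compose[OF this top]
  have lim2: "(\<lambda>n. \<integral>x. indicator {-real n..real n} x * u x * (?w x * exp (- \<i> * complex_of_real (p * x))) \<partial>lborel)
     \<longlonglongrightarrow> complex_of_real (1 / b) * exp (- \<i> * complex_of_real (p * q)) * (\<integral>k. g k * \<phi> k \<partial>lborel)"
    unfolding trunc by (intro tendsto_intros)
  have "(\<integral>x. u x * (?w x * exp (- \<i> * complex_of_real (p * x))) \<partial>lborel)
    = complex_of_real (1 / b) * exp (- \<i> * complex_of_real (p * q)) * (\<integral>k. g k * \<phi> k \<partial>lborel)"
    by (rule LIMSEQ_unique[OF lim1 lim2])
  then show ?thesis unfolding stft_def ft_def \<phi>_def mult.assoc .
qed

text \<open>On the Fourier side the window has scale 1 / b, so this is the spatial tail of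
  \<open>g\<close>. The reflection q -> - q preserves the measure, and the factor 1 / b^2 from the
  rotation turns sqrt pi / (1 / b) into sqrt pi / b. In the leakage term the norm of
  \<open>g\<close> is replaced by that of \<open>u\<close>.\<close>

lemma stft_frequency_tail:
  assumes u: "square_integrable lborel u" and g: "is_L2_fourier u g" and b: "b > 0" and S: "S \<ge> 0"
  shows "(\<integral>\<^sup>+z. indicator {p. \<bar>p\<bar> > 2 * S} (snd z) * ennreal ((cmod (stft b u (fst z) (snd z)))\<^sup>2) \<partial>(lborel \<Otimes>\<^sub>M lborel))
    \<le> ennreal (2 * pi * (sqrt pi / b) *
        ((l2norm lborel (\<lambda>k. indicator {k. \<bar>k\<bar> > S} k * g k))\<^sup>2 + 2 * exp (- (S\<^sup>2 / b\<^sup>2)) * (l2norm lborel u)\<^sup>2))"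
proof -
  have g2: "square_integrable lborel g"
    using g by (auto simp: is_L2_fourier_def sq_int_eq_square_integrable)
  have [measurable]: "u \<in> borel_measurable borel" "g \<in> borel_measurable borel"
    using u g2 by (auto simp: square_integrable_def)
  have ib: "1 / b > 0" using b by simp
  have [measurable]: "(\<lambda>z. stft b u (fst z) (snd z)) \<in> borel_measurable (lborel \<Otimes>\<^sub>M lborel)"
     "(\<lambda>z. stft (1 / b) g (fst z) (snd z)) \<in> borel_measurable (lborel \<Otimes>\<^sub>M lborel)"
    using measurable_stft[of u b] measurable_stft[of g "1 / b"] by (simp_all add: case_prod_beta')
  have [measurable]: "(\<lambda>q. stft (1 / b) g p q) \<in> borel_measurable borel" for p
    unfolding stft_def by measurable
  let ?S = "{p. \<bar>p\<bar> > 2 * S}"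
  let ?f = "\<lambda>z. indicator ?S (fst z) * ennreal ((cmod (stft (1 / b) g (fst z) (snd z)))\<^sup>2)"
  have "(\<integral>\<^sup>+z. indicator ?S (snd z) * ennreal ((cmod (stft b u (fst z) (snd z)))\<^sup>2) \<partial>(lborel \<Otimes>\<^sub>M lborel))
    = (\<integral>\<^sup>+p. (\<integral>\<^sup>+q. indicator ?S p * ennreal ((cmod (stft b u q p))\<^sup>2) \<partial>lborel) \<partial>lborel)"
    by (subst lborel_pair.nn_integral_snd[symmetric]) simp_all
  also have "\<dots> = (\<integral>\<^sup>+p. (\<integral>\<^sup>+q. ennreal (1 / b\<^sup>2) * ?f (p, q) \<partial>lborel) \<partial>lborel)"
  proof (rule nn_integral_cong)
    fix p
    have "(\<integral>\<^sup>+q. indicator ?S p * ennreal ((cmod (stft b u q p))\<^sup>2) \<partial>lborel)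
      = (\<integral>\<^sup>+q. ennreal (1 / b\<^sup>2) * ?f (p, 0 + (-1) * q) \<partial>lborel)"
    proof (rule nn_integral_cong)
      fix q
      have "(cmod (stft b u q p))\<^sup>2 = 1 / b\<^sup>2 * (cmod (stft (1 / b) g p (- q)))\<^sup>2"
        unfolding stft_fourier[OF u g b] norm_mult using b by (simp add: norm_divide power_mult_distrib power_divide)
      then show "indicator ?S p * ennreal ((cmod (stft b u q p))\<^sup>2) = ennreal (1 / b\<^sup>2) * ?f (p, 0 + (-1) * q)"
        by (simp only: fst_conv snd_conv ennreal_mult zero_le_power2 zero_le_divide_1_iff mult.left_commute add_0_left mult_minus1)
    qed
    also have "\<dots> = (\<integral>\<^sup>+q. ennreal (1 / b\<^sup>2) * ?f (p, q) \<partial>lborel)"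
      by (subst (2) nn_integral_real_affine[where c="-1" and t=0]) simp_all
    finally show "(\<integral>\<^sup>+q. indicator ?S p * ennreal ((cmod (stft b u q p))\<^sup>2) \<partial>lborel)
      = (\<integral>\<^sup>+q. ennreal (1 / b\<^sup>2) * ?f (p, q) \<partial>lborel)" .
  qed
  also have "\<dots> = (\<integral>\<^sup>+z. ennreal (1 / b\<^sup>2) * ?f z \<partial>(lborel \<Otimes>\<^sub>M lborel))"
    by (subst lborel.nn_integral_fst) measurable
  also have "\<dots> = ennreal (1 / b\<^sup>2) * (\<integral>\<^sup>+z. ?f z \<partial>(lborel \<Otimes>\<^sub>M lborel))"
    by (rule nn_integral_cmult) measurable
  also have "\<dots> \<le> ennreal (1 / b\<^sup>2) * ennreal (2 * pi * (sqrt pi / (1 / b)) *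
      ((l2norm lborel (\<lambda>k. indicator {k. \<bar>k\<bar> > S} k * g k))\<^sup>2 + 2 * exp (- ((1 / b)\<^sup>2 * S\<^sup>2)) * (l2norm lborel g)\<^sup>2))"
    by (rule mult_left_mono[OF stft_tail[OF g2 ib S]]) simp
  also have "\<dots> \<le> ennreal (1 / b\<^sup>2) * ennreal (2 * pi * (sqrt pi / (1 / b)) *
      ((l2norm lborel (\<lambda>k. indicator {k. \<bar>k\<bar> > S} k * g k))\<^sup>2 + 2 * exp (- ((1 / b)\<^sup>2 * S\<^sup>2)) * (l2norm lborel u)\<^sup>2))"
    using b by (intro mult_left_mono ennreal_leI add_left_mono power_mono L2_fourier_norm_le[OF u g]) auto
  also have "\<dots> = ennreal (1 / b\<^sup>2 * (2 * pi * (sqrt pi / (1 / b)) *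
      ((l2norm lborel (\<lambda>k. indicator {k. \<bar>k\<bar> > S} k * g k))\<^sup>2 + 2 * exp (- ((1 / b)\<^sup>2 * S\<^sup>2)) * (l2norm lborel u)\<^sup>2)))"
    using b by (intro ennreal_mult[symmetric]) auto
  also have "1 / b\<^sup>2 * (2 * pi * (sqrt pi / (1 / b)) *
      ((l2norm lborel (\<lambda>k. indicator {k. \<bar>k\<bar> > S} k * g k))\<^sup>2 + 2 * exp (- ((1 / b)\<^sup>2 * S\<^sup>2)) * (l2norm lborel u)\<^sup>2))
    = 2 * pi * (sqrt pi / b) *
        ((l2norm lborel (\<lambda>k. indicator {k. \<bar>k\<bar> > S} k * g k))\<^sup>2 + 2 * exp (- (S\<^sup>2 / b\<^sup>2)) * (l2norm lborel u)\<^sup>2)"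
    using b by (simp add: power2_eq_square)
  finally show ?thesis .
qed

section \<open>Functions orthogonal to the Hermite space\<close>

text \<open>Up to normalisation, the Bargmann transform at scale \<open>b\<close> without its factor
  exp (- \<zeta>^2 / (4 b^2)): entire in \<open>\<zeta>\<close>, with the moments of
  \<open>r\<close> against Gaussian monomials, divided by n!, as Taylor coefficients. The missing
  factor returns in the maximum principle argument.\<close>

definition gaussian_laplace :: "real \<Rightarrow> (real \<Rightarrow> complex) \<Rightarrow> complex \<Rightarrow> complex" where
  "gaussian_laplace b r \<zeta> = (\<integral>x. r x * (complex_of_real (exp (- (b\<^sup>2 * x\<^sup>2) / 2)) * exp (\<zeta> * complex_of_real x)) \<partial>lborel)"

text \<open>Expanding (x - q)^2 splits off exp (- b^2 q^2 / 2); the cross term is linear in x and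
  merges with the Fourier phase into the single complex frequency b^2 q - i p.\<close>

lemma stft_eq_gaussian_laplace:
  "stft b r q p = complex_of_real (exp (- (b\<^sup>2 * q\<^sup>2) / 2)) * gaussian_laplace b r (Complex (b\<^sup>2 * q) (- p))"
proof -
  have e: "complex_of_real (exp (- (b\<^sup>2 * (x - q)\<^sup>2) / 2)) * exp (- \<i> * complex_of_real (p * x))
    = complex_of_real (exp (- (b\<^sup>2 * q\<^sup>2) / 2)) * (complex_of_real (exp (- (b\<^sup>2 * x\<^sup>2) / 2)) * exp (Complex (b\<^sup>2 * q) (- p) * complex_of_real x))" for x
    unfolding exp_of_real[symmetric] exp_add[symmetric]
    by (rule arg_cong[where f=exp]) (simp add: Complex_eq power2_eq_square field_simps)
  then have "r x * complex_of_real (exp (- (b\<^sup>2 * (x - q)\<^sup>2) / 2)) * exp (- \<i> * complex_of_real (p * x))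
    = complex_of_real (exp (- (b\<^sup>2 * q\<^sup>2) / 2)) * (r x * (complex_of_real (exp (- (b\<^sup>2 * x\<^sup>2) / 2)) * exp (Complex (b\<^sup>2 * q) (- p) * complex_of_real x)))" for x
    by (metis (no_types, lifting) mult.assoc mult.left_commute)
  then have "stft b r q p = (\<integral>x. complex_of_real (exp (- (b\<^sup>2 * q\<^sup>2) / 2)) * (r x * (complex_of_real (exp (- (b\<^sup>2 * x\<^sup>2) / 2)) * exp (Complex (b\<^sup>2 * q) (- p) * complex_of_real x))) \<partial>lborel)"
    unfolding stft_def ft_def by (intro Bochner_Integration.integral_cong refl)
  then show ?thesis unfolding gaussian_laplace_def by (simp only: integral_mult_right_zero)
qed

lemma cmod_stft_le:
  assumes r: "square_integrable lborel r" and b: "b > 0"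
  shows "cmod (stft b r q p) \<le> l2norm lborel r * sqrt (sqrt pi / b)"
proof -
  have "cmod (stft b r q p) \<le> (\<integral>x. cmod (r x * complex_of_real (exp (- (b\<^sup>2 * (x - q)\<^sup>2) / 2))) \<partial>lborel)"
    unfolding stft_def by (rule cmod_ft_le)
  also have "\<dots> = (\<integral>x. cmod (r x) * cmod (complex_of_real (exp (- (b\<^sup>2 * (x - q)\<^sup>2) / 2))) \<partial>lborel)"
    by (simp only: norm_mult)
  also have "\<dots> \<le> l2norm lborel r * sqrt (sqrt pi / b)"
    using Cauchy_Schwarz_integral(2)[OF r gaussian_square_integrable(1)[OF b, of q]]
    unfolding gaussian_square_integrable(2)[OF b] .
  finally show ?thesis .
qed

text \<open>Every \<open>\<zeta>\<close> is the complex frequency of some phase-plane point, so this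
  is the uniform bound on \<open>stft\<close> with the Gaussian prefactor moved across.\<close>

lemma cmod_gaussian_laplace_le:
  assumes r: "square_integrable lborel r" and b: "b > 0"
  shows "cmod (gaussian_laplace b r \<zeta>) \<le> l2norm lborel r * sqrt (sqrt pi / b) * exp ((Re \<zeta>)\<^sup>2 / (2 * b\<^sup>2))"
proof -
  have z: "Complex (b\<^sup>2 * (Re \<zeta> / b\<^sup>2)) (- (- Im \<zeta>)) = \<zeta>" using b by (simp add: complex_eq_iff)
  have "b\<^sup>2 * (Re \<zeta> / b\<^sup>2)\<^sup>2 / 2 = (Re \<zeta>)\<^sup>2 / (2 * b\<^sup>2)" using b by (simp add: power2_eq_square)
  then have "cmod (stft b r (Re \<zeta> / b\<^sup>2) (- Im \<zeta>)) = exp (- ((Re \<zeta>)\<^sup>2 / (2 * b\<^sup>2))) * cmod (gaussian_laplace b r \<zeta>)"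
    unfolding stft_eq_gaussian_laplace z norm_mult by simp
  with cmod_stft_le[OF r b, of "Re \<zeta> / b\<^sup>2" "- Im \<zeta>"] show ?thesis
    by (simp add: exp_minus field_simps)
qed

text \<open>Half of the exponent completes the square with s |x|; the other half remains as a
  Gaussian of scale b / sqrt 2, still square-integrable.\<close>

lemma gaussian_mult_exp_le:
  fixes b s x :: real
  assumes b: "b > 0"
  shows "exp (- (b\<^sup>2 * x\<^sup>2) / 2) * exp (s * \<bar>x\<bar>) \<le> exp (s\<^sup>2 / b\<^sup>2) * exp (- ((b / sqrt 2)\<^sup>2 * (x - 0)\<^sup>2) / 2)"
proof -
  have "0 \<le> (b * \<bar>x\<bar> / 2 - s / b)\<^sup>2" by simp
  also have "\<dots> = b\<^sup>2 * x\<^sup>2 / 4 - s * \<bar>x\<bar> + s\<^sup>2 / b\<^sup>2"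
    using b by (simp add: power2_diff power_divide power_mult_distrib)
  finally show ?thesis by (simp add: exp_add[symmetric] power_divide)
qed

text \<open>The exponential series is integrated termwise. Its partial sums, even in absolute
  values, stay below exp (|\<zeta>| |x|), and the Gaussian absorbs that growth, so one majorant
  serves dominated convergence.\<close>

lemma gaussian_laplace_sums:
  assumes r: "square_integrable lborel r" and b: "b > 0"
  shows "(\<lambda>n. (\<integral>x. r x * (complex_of_real (exp (- (b\<^sup>2 * x\<^sup>2) / 2)) * complex_of_real x ^ n) \<partial>lborel) / fact n * \<zeta> ^ n)
    sums gaussian_laplace b r \<zeta>"
proof -
  have [measurable]: "r \<in> borel_measurable borel" using r by (auto simp: square_integrable_def)
  let ?g = "\<lambda>x. complex_of_real (exp (- (b\<^sup>2 * x\<^sup>2) / 2))"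
  let ?s = "cmod \<zeta>"
  let ?w = "\<lambda>s x. cmod (r x) * (exp (- (b\<^sup>2 * x\<^sup>2) / 2) * exp (s * \<bar>x\<bar>))"
  have w: "integrable lborel (?w s)" for s
  proof -
    have b': "b / sqrt 2 > 0" using b by simp
    note g = gaussian_square_integrable(1)[OF b', of 0]
    have i: "integrable lborel (\<lambda>x. cmod (r x) * cmod (complex_of_real (exp (- ((b / sqrt 2)\<^sup>2 * (x - 0)\<^sup>2) / 2))))"
      by (rule Cauchy_Schwarz_integral(1)[OF r g])
    show ?thesis
    proof (rule Bochner_Integration.integrable_bound[OF integrable_mult_right[OF i, of "exp (s\<^sup>2 / b\<^sup>2)"]])
      have "?w s x \<le> cmod (r x) * (exp (s\<^sup>2 / b\<^sup>2) * exp (- ((b / sqrt 2)\<^sup>2 * (x - 0)\<^sup>2) / 2))" for x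
        by (intro mult_left_mono gaussian_mult_exp_le b) auto
      then show "AE x in lborel. norm (?w s x) \<le> norm (exp (s\<^sup>2 / b\<^sup>2) * (cmod (r x) * cmod (complex_of_real (exp (- ((b / sqrt 2)\<^sup>2 * (x - 0)\<^sup>2) / 2)))))"
        by (auto simp: norm_mult mult_ac)
    qed measurable
  qed
  let ?p = "\<lambda>n x. r x * (?g x * ((\<zeta> * complex_of_real x) ^ n /\<^sub>R fact n))"
  have partial_le: "(\<Sum>n<k. cmod ((\<zeta> * complex_of_real x) ^ n /\<^sub>R fact n)) \<le> exp (?s * \<bar>x\<bar>)" for k x
  proof -
    have "(\<Sum>n<k. cmod ((\<zeta> * complex_of_real x) ^ n /\<^sub>R fact n)) = (\<Sum>n<k. (?s * \<bar>x\<bar>) ^ n /\<^sub>R fact n)"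
      by (intro sum.cong) (auto simp: norm_mult norm_power norm_divide)
    also have "\<dots> \<le> exp (?s * \<bar>x\<bar>)"
      unfolding exp_def by (rule sum_le_suminf[OF summable_exp_generic]) auto
    finally show ?thesis .
  qed
  have pi: "integrable lborel (?p n)" for n
  proof (rule Bochner_Integration.integrable_bound[OF w[of ?s]])
    have "cmod ((\<zeta> * complex_of_real x) ^ n /\<^sub>R fact n) \<le> exp (?s * \<bar>x\<bar>)" for x
    proof -
      have "cmod ((\<zeta> * complex_of_real x) ^ n /\<^sub>R fact n) \<le> (\<Sum>n<Suc n. cmod ((\<zeta> * complex_of_real x) ^ n /\<^sub>R fact n))"
        by (rule member_le_sum) auto
      then show ?thesis using partial_le[of x "Suc n"] by linarith
    qed
    then have "cmod (r x) * (exp (- (b\<^sup>2 * x\<^sup>2) / 2) * cmod ((\<zeta> * complex_of_real x) ^ n /\<^sub>R fact n)) \<le> ?w ?s x" for x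
      by (intro mult_left_mono) auto
    moreover have "norm (?p n x) = cmod (r x) * (exp (- (b\<^sup>2 * x\<^sup>2) / 2) * cmod ((\<zeta> * complex_of_real x) ^ n /\<^sub>R fact n))" for x
      by (simp add: norm_mult)
    ultimately show "AE x in lborel. norm (?p n x) \<le> norm (?w ?s x)"
      by (auto simp del: norm_scaleR)
  qed measurable
  have "(\<lambda>k. \<integral>x. (\<Sum>n<k. ?p n x) \<partial>lborel) \<longlonglongrightarrow> gaussian_laplace b r \<zeta>"
    unfolding gaussian_laplace_def
  proof (rule integral_dominated_convergence[OF _ _ w[of ?s]])
    have eq: "(\<Sum>n<k. ?p n x) = r x * (?g x * (\<Sum>n<k. (\<zeta> * complex_of_real x) ^ n /\<^sub>R fact n))" for k x
      by (simp only: sum_distrib_left)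
    show "AE x in lborel. (\<lambda>k. \<Sum>n<k. ?p n x) \<longlonglongrightarrow> r x * (?g x * exp (\<zeta> * complex_of_real x))"
    proof (rule AE_I2)
      fix x
      have "(\<lambda>k. \<Sum>n<k. (\<zeta> * complex_of_real x) ^ n /\<^sub>R fact n) \<longlonglongrightarrow> exp (\<zeta> * complex_of_real x)"
        using exp_converges[of "\<zeta> * complex_of_real x"] by (simp only: sums_def)
      then show "(\<lambda>k. \<Sum>n<k. ?p n x) \<longlonglongrightarrow> r x * (?g x * exp (\<zeta> * complex_of_real x))"
        unfolding eq by (intro tendsto_intros)
    qed
    show "AE x in lborel. norm (\<Sum>n<k. ?p n x) \<le> ?w ?s x" for k
    proof (rule AE_I2)
      fix x
      have "norm (\<Sum>n<k. ?p n x) = cmod (r x) * (exp (- (b\<^sup>2 * x\<^sup>2) / 2) * cmod (\<Sum>n<k. (\<zeta> * complex_of_real x) ^ n /\<^sub>R fact n))"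
        unfolding eq norm_mult norm_of_real abs_exp_cancel ..
      also have "\<dots> \<le> ?w ?s x"
        by (intro mult_left_mono order_trans[OF norm_sum partial_le]) auto
      finally show "norm (\<Sum>n<k. ?p n x) \<le> ?w ?s x" .
    qed
  qed measurable
  also have "(\<lambda>k. \<integral>x. (\<Sum>n<k. ?p n x) \<partial>lborel) = (\<lambda>k. \<Sum>n<k. \<integral>x. ?p n x \<partial>lborel)"
    using pi by (intro ext Bochner_Integration.integral_sum) auto
  finally have s: "(\<lambda>n. \<integral>x. ?p n x \<partial>lborel) sums gaussian_laplace b r \<zeta>" by (simp only: sums_def)
  have "(\<integral>x. ?p n x \<partial>lborel) = (\<integral>x. r x * (?g x * complex_of_real x ^ n) \<partial>lborel) / fact n * \<zeta> ^ n" for n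
  proof -
    have "(\<integral>x. ?p n x \<partial>lborel) = (\<integral>x. (\<zeta> ^ n / fact n) * (r x * (?g x * complex_of_real x ^ n)) \<partial>lborel)"
      by (intro Bochner_Integration.integral_cong) (auto simp: scaleR_conv_of_real power_mult_distrib field_simps)
    also have "\<dots> = (\<zeta> ^ n / fact n) * (\<integral>x. r x * (?g x * complex_of_real x ^ n) \<partial>lborel)"
      by (rule integral_mult_right_zero)
    finally show ?thesis by simp
  qed
  with s show ?thesis by simp
qed

text \<open>Schwarz lemma on the disc of radius \<open>sqrt 2 * \<bar>\<zeta>\<bar>\<close>: orthogonality makes the transform vanish to
  order \<open>N + 1\<close> at the origin.\<close>

lemma cmod_stft_orthogonal_le:
  assumes r: "square_integrable lborel r" and b: "b > 0"
    and orth: "\<And>n. n \<le> N \<Longrightarrow> (\<integral>x. r x * (complex_of_real (exp (- (b\<^sup>2 * x\<^sup>2) / 2)) * complex_of_real x ^ n) \<partial>lborel) = 0"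
  shows "cmod (stft b r q p) \<le> l2norm lborel r * sqrt (sqrt pi / b) / sqrt 2 ^ Suc N * exp ((b\<^sup>2 * q\<^sup>2 + p\<^sup>2 / b\<^sup>2) / 4)"
proof -
  define a where "a n = (\<integral>x. r x * (complex_of_real (exp (- (b\<^sup>2 * x\<^sup>2) / 2)) * complex_of_real x ^ n) \<partial>lborel) / fact n" for n
  let ?F = "gaussian_laplace b r"
  let ?C = "l2norm lborel r * sqrt (sqrt pi / b)"
  have a0: "a n = 0" if "n < Suc N" for n using orth[of n] that by (simp add: a_def)
  have sums: "(\<lambda>n. a n * \<zeta> ^ n) sums ?F \<zeta>" for \<zeta>
    using gaussian_laplace_sums[OF r b, of \<zeta>] by (simp add: a_def)
  define H where "H \<zeta> = (\<Sum>n. a (n + Suc N) * \<zeta> ^ n)" for \<zeta>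
  have Hs: "(\<lambda>n. a (n + Suc N) * \<zeta> ^ n) sums H \<zeta>" for \<zeta>
    unfolding H_def
    by (rule summable_sums) (use sums_summable[OF sums, of \<zeta>] in \<open>simp only: summable_powser_ignore_initial_segment\<close>)
  have FH: "?F \<zeta> = \<zeta> ^ Suc N * H \<zeta>" for \<zeta>
  proof -
    have "(\<lambda>n. \<zeta> ^ Suc N * (a (n + Suc N) * \<zeta> ^ n)) sums (\<zeta> ^ Suc N * H \<zeta>)"
      by (rule sums_mult[OF Hs])
    moreover have "(\<lambda>n. \<zeta> ^ Suc N * (a (n + Suc N) * \<zeta> ^ n)) = (\<lambda>n. a (n + Suc N) * \<zeta> ^ (n + Suc N))"
      by (simp add: power_add mult_ac)
    moreover have "(\<lambda>n. a (n + Suc N) * \<zeta> ^ (n + Suc N)) sums (?F \<zeta> - (\<Sum>i<Suc N. a i * \<zeta> ^ i))"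
      by (rule sums_split_initial_segment[OF sums])
    moreover have "(\<Sum>i<Suc N. a i * \<zeta> ^ i) = 0" by (rule sum.neutral) (simp add: a0)
    ultimately show ?thesis by (metis diff_0_right sums_unique2)
  qed
  have Hh: "H holomorphic_on A" for A
  proof -
    have "H holomorphic_on ball 0 R" for R
      by (rule power_series_holomorphic[where a="\<lambda>n. a (n + Suc N)"]) (simp only: diff_0_right Hs)
    then have "H field_differentiable (at z)" for z
      using holomorphic_on_imp_differentiable_at[of H "ball 0 (norm z + 1)" z] by simp
    then show ?thesis by (auto simp: holomorphic_on_def intro: field_differentiable_at_within)
  qed
  \<comment> \<open>The factor makes the growth radial: \<open>?F\<close> alone is bounded through
    exp ((Re \<zeta>)^2 / (2 b^2)), and after multiplication the exponent is |\<zeta>|^2 / (4 b^2),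
    constant on circles. Its modulus is explicit, so it can be undone afterwards.\<close>
  define G where "G \<zeta> = H \<zeta> * exp (- (\<zeta>\<^sup>2) / complex_of_real (4 * b\<^sup>2))" for \<zeta>
  have Gh: "G holomorphic_on A" for A
    unfolding G_def by (intro holomorphic_intros Hh) (use b in auto)
  have Re_sq: "Re (- (\<zeta>\<^sup>2) / complex_of_real (4 * b\<^sup>2)) = ((Im \<zeta>)\<^sup>2 - (Re \<zeta>)\<^sup>2) / (4 * b\<^sup>2)" for \<zeta>
    by (simp only: Re_divide_of_real) (simp add: power2_eq_square)
  have circle: "cmod (G \<xi>) \<le> ?C * exp (R\<^sup>2 / (4 * b\<^sup>2)) / R ^ Suc N" if R: "R > 0" "cmod \<xi> = R" for R \<xi>
  proof -
    have "R ^ Suc N * cmod (G \<xi>) = cmod (?F \<xi>) * exp (((Im \<xi>)\<^sup>2 - (Re \<xi>)\<^sup>2) / (4 * b\<^sup>2))"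
      unfolding FH G_def norm_mult norm_power R(2) norm_exp_eq_Re Re_sq by simp
    also have "\<dots> \<le> (?C * exp ((Re \<xi>)\<^sup>2 / (2 * b\<^sup>2))) * exp (((Im \<xi>)\<^sup>2 - (Re \<xi>)\<^sup>2) / (4 * b\<^sup>2))"
      by (intro mult_right_mono cmod_gaussian_laplace_le[OF r b]) auto
    also have "\<dots> = ?C * exp (((Re \<xi>)\<^sup>2 + (Im \<xi>)\<^sup>2) / (4 * b\<^sup>2))"
      using b by (simp add: exp_add[symmetric] field_simps)
    also have "(Re \<xi>)\<^sup>2 + (Im \<xi>)\<^sup>2 = R\<^sup>2" using R(2) cmod_power2 by metis
    finally show ?thesis using R(1) by (simp add: field_simps)
  qed
  have F_le: "cmod (?F \<zeta>) \<le> ?C / sqrt 2 ^ Suc N * exp ((cmod \<zeta>)\<^sup>2 / (2 * b\<^sup>2)) * exp (((Re \<zeta>)\<^sup>2 - (Im \<zeta>)\<^sup>2) / (4 * b\<^sup>2))" for \<zeta>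
  proof (cases "\<zeta> = 0")
    \<comment> \<open>The disc degenerates here; the zero of order at least 1 at the origin settles
      the point directly.\<close>
    case True
    then have "?F \<zeta> = 0" by (simp add: FH)
    then show ?thesis using b by simp
  next
    case False
    \<comment> \<open>With ratio s of the radii the bound is proportional to exp (s^2 |\<zeta>|^2 /
      (4 b^2)) / s^(N+1), minimal at s^2 = 2 (N+1) b^2 / |\<zeta>|^2. At the corners of the box used
      later |\<zeta>|^2 / b^2 = N, so s = sqrt 2 is optimal there up to replacing N+1 by N.\<close>
    let ?R = "sqrt 2 * cmod \<zeta>"
    have R: "?R > 0" using False by simp
    have "cmod (G \<zeta>) \<le> ?C * exp (?R\<^sup>2 / (4 * b\<^sup>2)) / ?R ^ Suc N"
    proof (rule maximum_modulus_frontier[where f=G and S="cball 0 ?R"])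
      show "cmod (G z) \<le> ?C * exp (?R\<^sup>2 / (4 * b\<^sup>2)) / ?R ^ Suc N" if "z \<in> frontier (cball 0 ?R)" for z
        by (rule circle[OF R]) (use that R in \<open>auto simp: dist_norm\<close>)
      show "\<zeta> \<in> cball 0 ?R"
        using mult_right_mono[of 1 "sqrt 2" "cmod \<zeta>"] by simp
    qed (auto intro: Gh holomorphic_on_imp_continuous_on)
    also have "?R\<^sup>2 / (4 * b\<^sup>2) = (cmod \<zeta>)\<^sup>2 / (2 * b\<^sup>2)" by (simp add: power_mult_distrib)
    finally have G_le: "cmod (G \<zeta>) \<le> ?C * exp ((cmod \<zeta>)\<^sup>2 / (2 * b\<^sup>2)) / ?R ^ Suc N" .
    have "cmod (G \<zeta>) * exp (((Re \<zeta>)\<^sup>2 - (Im \<zeta>)\<^sup>2) / (4 * b\<^sup>2)) = cmod (H \<zeta>)"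
      unfolding G_def norm_mult norm_exp_eq_Re Re_sq mult.assoc exp_add[symmetric]
      by (simp add: diff_divide_distrib)
    then have "cmod (?F \<zeta>) = cmod \<zeta> ^ Suc N * (cmod (G \<zeta>) * exp (((Re \<zeta>)\<^sup>2 - (Im \<zeta>)\<^sup>2) / (4 * b\<^sup>2)))"
      by (simp add: FH norm_mult norm_power)
    also have "\<dots> \<le> cmod \<zeta> ^ Suc N * ((?C * exp ((cmod \<zeta>)\<^sup>2 / (2 * b\<^sup>2)) / ?R ^ Suc N) * exp (((Re \<zeta>)\<^sup>2 - (Im \<zeta>)\<^sup>2) / (4 * b\<^sup>2)))"
      by (intro mult_left_mono mult_right_mono G_le) auto
    also have "\<dots> = ?C / sqrt 2 ^ Suc N * exp ((cmod \<zeta>)\<^sup>2 / (2 * b\<^sup>2)) * exp (((Re \<zeta>)\<^sup>2 - (Im \<zeta>)\<^sup>2) / (4 * b\<^sup>2))"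
      using False by (simp add: power_mult_distrib field_simps)
    finally show ?thesis .
  qed
  let ?z = "Complex (b\<^sup>2 * q) (- p)"
  have "cmod (stft b r q p) = exp (- (b\<^sup>2 * q\<^sup>2) / 2) * cmod (?F ?z)"
    by (simp add: stft_eq_gaussian_laplace norm_mult)
  also have "\<dots> \<le> exp (- (b\<^sup>2 * q\<^sup>2) / 2) * (?C / sqrt 2 ^ Suc N * exp ((cmod ?z)\<^sup>2 / (2 * b\<^sup>2)) * exp (((Re ?z)\<^sup>2 - (Im ?z)\<^sup>2) / (4 * b\<^sup>2)))"
    by (intro mult_left_mono F_le) auto
  also have "\<dots> = ?C / sqrt 2 ^ Suc N * exp (- (b\<^sup>2 * q\<^sup>2) / 2 + (cmod ?z)\<^sup>2 / (2 * b\<^sup>2) + ((Re ?z)\<^sup>2 - (Im ?z)\<^sup>2) / (4 * b\<^sup>2))"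
    unfolding exp_add by (simp only: mult_ac)
  \<comment> \<open>All the Gaussian factors collapse into a form symmetric in the scaled position b
    q and the scaled frequency p / b.\<close>
  also have "- (b\<^sup>2 * q\<^sup>2) / 2 + (cmod ?z)\<^sup>2 / (2 * b\<^sup>2) + ((Re ?z)\<^sup>2 - (Im ?z)\<^sup>2) / (4 * b\<^sup>2) = (b\<^sup>2 * q\<^sup>2 + p\<^sup>2 / b\<^sup>2) / 4"
    unfolding cmod_power2 using b by (simp add: field_simps power2_eq_square)
  finally show ?thesis .
qed

text \<open>A single term of the exponential series gives |x|^n <= n! exp |x|, so a Gaussian times a
  monomial is dominated by a wider Gaussian; polynomials follow by linearity.\<close>

lemma hermite_space_square_integrable:
  assumes w: "w \<in> hermite_space b N" and b: "b > 0"
  shows "square_integrable lborel w"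
proof -
  let ?g = "\<lambda>x. complex_of_real (exp (- (b\<^sup>2 * x\<^sup>2) / 2))"
  obtain \<psi> :: "complex poly" where \<psi>: "w = (\<lambda>x. ?g x * poly \<psi> (complex_of_real x))"
    using w by (auto simp: hermite_space_def)
  have b': "b / sqrt 2 > 0" using b by simp
  have mono: "square_integrable lborel (\<lambda>x. ?g x * complex_of_real x ^ n)" for n
  proof (rule square_integrable_mono(1)[OF square_integrable_cmult[OF gaussian_square_integrable(1)[OF b', of 0], of "complex_of_real (fact n * exp (1\<^sup>2 / b\<^sup>2))"]])
    fix x :: real
    have "\<bar>x\<bar> ^ n /\<^sub>R fact n = (\<Sum>k\<in>{n}. \<bar>x\<bar> ^ k /\<^sub>R fact k)" by simp
    also have "\<dots> \<le> exp \<bar>x\<bar>"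
      unfolding exp_def by (rule sum_le_suminf[OF summable_exp_generic]) auto
    finally have "\<bar>x\<bar> ^ n \<le> fact n * exp (1 * \<bar>x\<bar>)" by (simp add: field_simps)
    then have "exp (- (b\<^sup>2 * x\<^sup>2) / 2) * \<bar>x\<bar> ^ n \<le> fact n * (exp (- (b\<^sup>2 * x\<^sup>2) / 2) * exp (1 * \<bar>x\<bar>))"
      by simp
    also have "\<dots> \<le> fact n * (exp (1\<^sup>2 / b\<^sup>2) * exp (- ((b / sqrt 2)\<^sup>2 * (x - 0)\<^sup>2) / 2))"
      by (intro mult_left_mono gaussian_mult_exp_le b) auto
    finally show "cmod (?g x * complex_of_real x ^ n)
       \<le> cmod (complex_of_real (fact n * exp (1\<^sup>2 / b\<^sup>2)) * complex_of_real (exp (- ((b / sqrt 2)\<^sup>2 * (x - 0)\<^sup>2) / 2)))"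
      by (simp add: norm_mult norm_power)
  qed measurable
  have "square_integrable lborel (\<lambda>x. \<Sum>i\<in>I. coeff \<psi> i * (?g x * complex_of_real x ^ i))" if "finite I" for I
    using that
  proof (induction I)
    case empty
    show ?case by (simp add: square_integrable_def)
  next
    case (insert i I)
    then show ?case
      using square_integrable_add(1)[OF square_integrable_cmult[OF mono] insert.IH] by simp
  qed
  moreover have "w = (\<lambda>x. \<Sum>i\<le>degree \<psi>. coeff \<psi> i * (?g x * complex_of_real x ^ i))"
    unfolding \<psi> poly_altdef sum_distrib_left by (intro ext sum.cong refl mult.left_commute)
  ultimately show ?thesis by simp
qed

section \<open>Combining the estimates in the phase plane\<close>

lemma l2norm_add_power2:
  assumes f: "square_integrable M f" and g: "square_integrable M g"
  shows "(l2norm M (\<lambda>x. f x + g x))\<^sup>2 = (l2norm M f)\<^sup>2 + (l2norm M g)\<^sup>2 + 2 * Re (\<integral>x. f x * cnj (g x) \<partial>M)"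
proof -
  note i = square_integrable_mult_integrable(1)[OF f square_integrable_cnj[OF g]]
  have "(cmod (f x + g x))\<^sup>2 = (cmod (f x))\<^sup>2 + (cmod (g x))\<^sup>2 + 2 * Re (f x * cnj (g x))" for x
    by (simp only: cmod_power2) (simp add: power2_eq_square algebra_simps)
  then have "(l2norm M (\<lambda>x. f x + g x))\<^sup>2 = (\<integral>x. (cmod (f x))\<^sup>2 + (cmod (g x))\<^sup>2 + 2 * Re (f x * cnj (g x)) \<partial>M)"
    unfolding l2norm_power2 by (simp only:)
  also have "\<dots> = (\<integral>x. (cmod (f x))\<^sup>2 + (cmod (g x))\<^sup>2 \<partial>M) + (\<integral>x. 2 * Re (f x * cnj (g x)) \<partial>M)"
    using f g i by (intro Bochner_Integration.integral_add integrable_mult_right integrable_Re Bochner_Integration.integrable_add)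
      (auto simp: square_integrable_def)
  also have "\<dots> = (l2norm M f)\<^sup>2 + (l2norm M g)\<^sup>2 + 2 * Re (\<integral>x. f x * cnj (g x) \<partial>M)"
    using f g unfolding l2norm_power2 integral_mult_right_zero integral_Re[OF i]
    by (simp add: square_integrable_def)
  finally show ?thesis .
qed

text \<open>The isometry transports Pythagoras: \<open>u\<close>, \<open>r\<close>, \<open>w\<close>
  and their transforms satisfy the same relation between squared norms, which forces the real part
  of the pairing of the transforms of \<open>r\<close> and \<open>w\<close> to vanish. That real
  part is all the inequality uses.\<close>

lemma stft_orthogonal_decomposition:
  assumes r: "square_integrable lborel r" and w: "square_integrable lborel w"
    and u: "u = (\<lambda>x. r x + w x)" and orth: "L2_inner r w = 0" and b: "b > 0"
  shows "2 * pi * (sqrt pi / b) * (l2norm lborel r)\<^sup>2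
    \<le> (\<integral>z. cmod (stft b r (fst z) (snd z)) * cmod (stft b u (fst z) (snd z)) \<partial>(lborel \<Otimes>\<^sub>M lborel))"
proof -
  let ?M = "(lborel :: real measure) \<Otimes>\<^sub>M (lborel :: real measure)"
  let ?V = "\<lambda>f z. stft b f (fst z) (snd z)"
  let ?\<kappa> = "2 * pi * (sqrt pi / b)"
  have u2: "square_integrable lborel u" unfolding u by (rule square_integrable_add(1)[OF r w])
  note iso = stft_isometry(1)[OF _ b]
  have V: "?V u z = ?V r z + ?V w z" for z
  proof -
    have "r = (\<lambda>x. u x - w x)" by (simp add: u)
    then show ?thesis using stft_diff[OF u2 w b] by simp
  qed
  have "(l2norm lborel u)\<^sup>2 = (l2norm lborel r)\<^sup>2 + (l2norm lborel w)\<^sup>2"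
    using l2norm_add_power2[OF r w] orth by (simp add: u L2_inner_def)
  then have "?\<kappa> * (l2norm lborel u)\<^sup>2 = ?\<kappa> * (l2norm lborel r)\<^sup>2 + ?\<kappa> * (l2norm lborel w)\<^sup>2"
    by (simp add: distrib_left)
  moreover have "(l2norm ?M (?V u))\<^sup>2 = (l2norm ?M (?V r))\<^sup>2 + (l2norm ?M (?V w))\<^sup>2 + 2 * Re (\<integral>z. ?V r z * cnj (?V w z) \<partial>?M)"
    using l2norm_add_power2[OF iso[OF r] iso[OF w]] by (simp only: V)
  ultimately have 0: "Re (\<integral>z. ?V r z * cnj (?V w z) \<partial>?M) = 0"
    unfolding stft_isometry(2)[OF u2 b] stft_isometry(2)[OF r b] stft_isometry(2)[OF w b] by simp
  note irw = square_integrable_mult_integrable(1)[OF iso[OF r] square_integrable_cnj[OF iso[OF w]]]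
  note irr = square_integrable_mult_integrable(1)[OF iso[OF r] square_integrable_cnj[OF iso[OF r]]]
  have "(\<integral>z. ?V r z * cnj (?V u z) \<partial>?M) = (\<integral>z. ?V r z * cnj (?V r z) \<partial>?M) + (\<integral>z. ?V r z * cnj (?V w z) \<partial>?M)"
    unfolding V complex_cnj_add distrib_left by (rule Bochner_Integration.integral_add[OF irr irw])
  moreover have "(\<integral>z. ?V r z * cnj (?V r z) \<partial>?M) = complex_of_real ((l2norm ?M (?V r))\<^sup>2)"
    unfolding l2norm_power2 integral_complex_of_real[symmetric] complex_norm_square ..
  ultimately have "?\<kappa> * (l2norm lborel r)\<^sup>2 = Re (\<integral>z. ?V r z * cnj (?V u z) \<partial>?M)"
    using 0 unfolding stft_isometry(2)[OF r b] by simp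
  also have "\<dots> \<le> cmod (\<integral>z. ?V r z * cnj (?V u z) \<partial>?M)" by (rule complex_Re_le_cmod)
  also have "\<dots> \<le> (\<integral>z. cmod (?V r z * cnj (?V u z)) \<partial>?M)" by (rule integral_norm_bound)
  finally show ?thesis by (simp add: norm_mult)
qed

text \<open>The bound ln 2 >= 2/3 pays exactly for 1/2 + 1/8 + 1/24; the share 1/24 absorbs the
  factor N through N <= 24 exp (N / 24), which is where 24 comes from.\<close>

lemma exp_half_over_power2_le: "real N * exp (real N / 2) / 2 ^ N \<le> 24 * exp (- (real N / 8))"
proof -
  have "real N / 24 \<le> exp (real N / 24)" using exp_ge_add_one_self[of "real N / 24"] by linarith
  then have "real N * exp (5 / 8 * real N) \<le> (24 * exp (real N / 24)) * exp (5 / 8 * real N)"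
    by (intro mult_right_mono) auto
  also have "\<dots> = 24 * exp (real N * (2 / 3))" by (simp add: exp_add[symmetric])
  also have "\<dots> \<le> 24 * exp (real N * ln 2)" using mult_left_mono[OF ln2_ge_two_thirds, of "real N"] by simp
  also have "exp (real N * ln 2) = 2 ^ N" by (simp add: exp_of_nat_mult)
  finally have "real N * (exp (real N / 2) * exp (real N / 8)) \<le> 24 * 2 ^ N"
    by (simp add: exp_add[symmetric])
  then show ?thesis by (simp add: exp_minus field_simps)
qed

text \<open>Pointwise bound times area. On the box b^2 q^2 and p^2 / b^2 are at most N / 2, so the
  exponent is at most N / 4, and N / 2 after squaring; the area is 16 T S = 2 N.\<close>

lemma stft_orthogonal_box:
  assumes r: "square_integrable lborel r" and b: "b > 0"
    and orth: "\<And>n. n \<le> N \<Longrightarrow> (\<integral>x. r x * (complex_of_real (exp (- (b\<^sup>2 * x\<^sup>2) / 2)) * complex_of_real x ^ n) \<partial>lborel) = 0"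
    and T: "T \<ge> 0" "b\<^sup>2 * T\<^sup>2 = real N / 8" and S: "S \<ge> 0" "S\<^sup>2 / b\<^sup>2 = real N / 8"
  shows "(l2norm (lborel \<Otimes>\<^sub>M lborel) (\<lambda>z. indicator ({-2 * T..2 * T} \<times> {-2 * S..2 * S}) z * stft b r (fst z) (snd z)))\<^sup>2
    \<le> 2 * pi * (sqrt pi / b) * (2 * exp (- (real N / 16)) * l2norm lborel r)\<^sup>2"
proof -
  let ?M = "(lborel :: real measure) \<Otimes>\<^sub>M (lborel :: real measure)"
  let ?D = "{-2 * T..2 * T} \<times> {-2 * S..2 * S}"
  let ?V = "\<lambda>z. stft b r (fst z) (snd z)"
  let ?K = "sqrt pi / b"
  let ?c = "(l2norm lborel r)\<^sup>2 * ?K / 2 ^ Suc N * exp (real N / 2)"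
  have K: "?K > 0" using b by simp
  have D: "?D \<in> sets ?M" by simp
  have bound: "(cmod (?V z))\<^sup>2 \<le> ?c" if "z \<in> ?D" for z
  proof -
    obtain q p where z: "z = (q, p)" by (cases z)
    have "\<bar>q\<bar> \<le> 2 * T" "\<bar>p\<bar> \<le> 2 * S" using that by (auto simp: z)
    then have "q\<^sup>2 \<le> (2 * T)\<^sup>2" "p\<^sup>2 \<le> (2 * S)\<^sup>2"
      by (metis abs_ge_zero power2_abs power_mono)+
    then have "b\<^sup>2 * q\<^sup>2 \<le> b\<^sup>2 * (2 * T)\<^sup>2" "p\<^sup>2 / b\<^sup>2 \<le> (2 * S)\<^sup>2 / b\<^sup>2"
      by (auto intro: mult_left_mono divide_right_mono)
    moreover have "b\<^sup>2 * (2 * T)\<^sup>2 = 4 * (b\<^sup>2 * T\<^sup>2)" "(2 * S)\<^sup>2 / b\<^sup>2 = 4 * (S\<^sup>2 / b\<^sup>2)"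
      by (simp_all add: power_mult_distrib)
    ultimately have h: "b\<^sup>2 * q\<^sup>2 \<le> 4 * (real N / 8)" "p\<^sup>2 / b\<^sup>2 \<le> 4 * (real N / 8)"
      by (simp_all only: T(2) S(2))
    have "(b\<^sup>2 * q\<^sup>2 + p\<^sup>2 / b\<^sup>2) / 4 \<le> real N / 4"
      by (rule order_trans[OF divide_right_mono[OF add_mono[OF h]]]) simp_all
    then have "l2norm lborel r * sqrt ?K / sqrt 2 ^ Suc N * exp ((b\<^sup>2 * q\<^sup>2 + p\<^sup>2 / b\<^sup>2) / 4)
        \<le> l2norm lborel r * sqrt ?K / sqrt 2 ^ Suc N * exp (real N / 4)"
      using K by (intro mult_left_mono) auto
    with cmod_stft_orthogonal_le[OF r b orth, of N q p]
    have "cmod (?V z) \<le> l2norm lborel r * sqrt ?K / sqrt 2 ^ Suc N * exp (real N / 4)"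
      by (simp add: z)
    then have "(cmod (?V z))\<^sup>2 \<le> (l2norm lborel r * sqrt ?K / sqrt 2 ^ Suc N * exp (real N / 4))\<^sup>2"
      by (rule power_mono) simp
    also have "\<dots> = (l2norm lborel r)\<^sup>2 * (sqrt ?K)\<^sup>2 / ((sqrt 2)\<^sup>2) ^ Suc N * (exp (real N / 4))\<^sup>2"
      unfolding power_mult_distrib power_divide power_mult[symmetric] mult.commute[of "Suc N" 2] ..
    also have "(exp (real N / 4))\<^sup>2 = exp (real N / 2)" by (simp flip: exp_double)
    also have "(sqrt ?K)\<^sup>2 = ?K" using K by simp
    finally show ?thesis by simp
  qed
  have "(\<integral>\<^sup>+z. ennreal ((cmod (indicator ?D z * ?V z))\<^sup>2) \<partial>?M) \<le> (\<integral>\<^sup>+z. ennreal ?c * indicator ?D z \<partial>?M)"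
    using bound by (intro nn_integral_mono) (auto split: split_indicator intro: ennreal_leI)
  also have "\<dots> = ennreal ?c * emeasure ?M ?D" by (rule nn_integral_cmult_indicator[OF D])
  also have "emeasure ?M ?D = ennreal (4 * T) * ennreal (4 * S)"
    using T(1) S(1) by (subst lborel.emeasure_pair_measure_Times) auto
  also have "\<dots> = ennreal (2 * real N)"
  proof -
    have "(T * S)\<^sup>2 = (b\<^sup>2 * T\<^sup>2) * (S\<^sup>2 / b\<^sup>2)" using b by (simp add: power_mult_distrib)
    also have "\<dots> = (real N / 8)\<^sup>2" unfolding T(2) S(2) by (simp add: power2_eq_square)
    finally have "T * S = real N / 8" using T(1) S(1) by (simp add: power2_eq_iff_nonneg)
    then show ?thesis using T(1) S(1) by (simp add: ennreal_mult[symmetric] mult_ac)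
  qed
  also have "ennreal ?c * ennreal (2 * real N) = ennreal (?K * (l2norm lborel r)\<^sup>2 * (real N * exp (real N / 2) / 2 ^ N))"
    using b by (subst ennreal_mult[symmetric]) (simp_all add: field_simps)
  also have "\<dots> \<le> ennreal (2 * pi * ?K * (2 * exp (- (real N / 16)) * l2norm lborel r)\<^sup>2)"
  proof (rule ennreal_leI)
    have "?K * (l2norm lborel r)\<^sup>2 * (real N * exp (real N / 2) / 2 ^ N)
      \<le> ?K * (l2norm lborel r)\<^sup>2 * (24 * exp (- (real N / 8)))"
      using b by (intro mult_left_mono exp_half_over_power2_le) auto
    \<comment> \<open>24 is split as 6 times 4: 6 < 2 pi completes the isometry constant, and 4 is
      the square of the factor 2 in the claim.\<close>
    also have "\<dots> = 6 * (?K * (l2norm lborel r)\<^sup>2 * (4 * exp (- (real N / 8))))" by simp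
    also have "\<dots> \<le> (2 * pi) * (?K * (l2norm lborel r)\<^sup>2 * (4 * exp (- (real N / 8))))"
      using b pi_gt3 by (intro mult_right_mono) auto
    also have "exp (- (real N / 8)) = (exp (- (real N / 16)))\<^sup>2" by (simp flip: exp_double)
    finally show "?K * (l2norm lborel r)\<^sup>2 * (real N * exp (real N / 2) / 2 ^ N)
      \<le> 2 * pi * ?K * (2 * exp (- (real N / 16)) * l2norm lborel r)\<^sup>2"
      by (simp add: power_mult_distrib mult_ac)
  qed
  finally have le: "(\<integral>\<^sup>+z. ennreal ((cmod (indicator ?D z * ?V z))\<^sup>2) \<partial>?M)
    \<le> ennreal (2 * pi * ?K * (2 * exp (- (real N / 16)) * l2norm lborel r)\<^sup>2)" .
  have m: "(\<lambda>z. indicator ?D z * ?V z) \<in> borel_measurable ?M"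
    using square_integrable_indicator(1)[OF stft_isometry(1)[OF r b] D] by (simp add: square_integrable_def)
  show ?thesis
    by (rule square_integrableI_nn_integral(2)[OF m le]) (use b in auto)
qed

text \<open>Outside the box position or frequency exceeds twice its radius, so the two tail
  estimates add. Their two leakage terms 2 exp (- N / 8) together form the square of 2 exp (- N /
  16), and a sum of squares of nonnegative numbers is at most the square of the sum.\<close>

lemma stft_outside_box:
  assumes u: "square_integrable lborel u" and g: "is_L2_fourier u g" and b: "b > 0"
    and T: "T \<ge> 0" "b\<^sup>2 * T\<^sup>2 = real N / 8" and S: "S \<ge> 0" "S\<^sup>2 / b\<^sup>2 = real N / 8"
  shows "(l2norm (lborel \<Otimes>\<^sub>M lborel) (\<lambda>z. indicator (- ({-2 * T..2 * T} \<times> {-2 * S..2 * S})) z * stft b u (fst z) (snd z)))\<^sup>2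
    \<le> 2 * pi * (sqrt pi / b) * (l2norm lborel (\<lambda>x. indicator {x. \<bar>x\<bar> > T} x * u x)
       + l2norm lborel (\<lambda>k. indicator {k. \<bar>k\<bar> > S} k * g k) + 2 * exp (- (real N / 16)) * l2norm lborel u)\<^sup>2"
proof -
  let ?M = "(lborel :: real measure) \<Otimes>\<^sub>M (lborel :: real measure)"
  let ?D = "- ({-2 * T..2 * T} \<times> {-2 * S..2 * S})"
  let ?V = "\<lambda>z. stft b u (fst z) (snd z)"
  let ?\<kappa> = "2 * pi * (sqrt pi / b)"
  let ?t1 = "l2norm lborel (\<lambda>x. indicator {x. \<bar>x\<bar> > T} x * u x)"
  let ?t2 = "l2norm lborel (\<lambda>k. indicator {k. \<bar>k\<bar> > S} k * g k)"
  let ?n = "l2norm lborel u" and ?e = "exp (- (real N / 16))"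
  have \<kappa>: "?\<kappa> > 0" using b by simp
  have e2: "exp (- (real N / 8)) = ?e\<^sup>2" by (simp flip: exp_double)
  note V2 = stft_isometry(1)[OF u b]
  have [measurable]: "?V \<in> borel_measurable ?M" using V2 by (simp add: square_integrable_def)
  have "{-2 * T..2 * T} \<times> {-2 * S..2 * S} \<in> sets ?M" by simp
  from sets.compl_sets[OF this] have D: "?D \<in> sets ?M"
    by (simp add: space_pair_measure Compl_eq_Diff_UNIV)
  have "(\<integral>\<^sup>+z. ennreal ((cmod (indicator ?D z * ?V z))\<^sup>2) \<partial>?M)
    \<le> (\<integral>\<^sup>+z. indicator {q. \<bar>q\<bar> > 2 * T} (fst z) * ennreal ((cmod (?V z))\<^sup>2)
        + indicator {p. \<bar>p\<bar> > 2 * S} (snd z) * ennreal ((cmod (?V z))\<^sup>2) \<partial>?M)"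
    by (intro nn_integral_mono) (auto split: split_indicator)
  also have "\<dots> = (\<integral>\<^sup>+z. indicator {q. \<bar>q\<bar> > 2 * T} (fst z) * ennreal ((cmod (?V z))\<^sup>2) \<partial>?M)
        + (\<integral>\<^sup>+z. indicator {p. \<bar>p\<bar> > 2 * S} (snd z) * ennreal ((cmod (?V z))\<^sup>2) \<partial>?M)"
    by (rule nn_integral_add) measurable
  also have "\<dots> \<le> ennreal (?\<kappa> * (?t1\<^sup>2 + 2 * exp (- (b\<^sup>2 * T\<^sup>2)) * ?n\<^sup>2)) + ennreal (?\<kappa> * (?t2\<^sup>2 + 2 * exp (- (S\<^sup>2 / b\<^sup>2)) * ?n\<^sup>2))"
    by (rule add_mono[OF stft_tail[OF u b T(1)] stft_frequency_tail[OF u g b S(1)]])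
  also have "\<dots> = ennreal (?\<kappa> * (?t1\<^sup>2 + 2 * ?e\<^sup>2 * ?n\<^sup>2) + ?\<kappa> * (?t2\<^sup>2 + 2 * ?e\<^sup>2 * ?n\<^sup>2))"
    unfolding T(2) S(2) e2 using b by (intro ennreal_plus[symmetric] mult_nonneg_nonneg) auto
  also have "?\<kappa> * (?t1\<^sup>2 + 2 * ?e\<^sup>2 * ?n\<^sup>2) + ?\<kappa> * (?t2\<^sup>2 + 2 * ?e\<^sup>2 * ?n\<^sup>2) = ?\<kappa> * (?t1\<^sup>2 + ?t2\<^sup>2 + (2 * (?e * ?n))\<^sup>2)"
    by (simp only: distrib_left power_mult_distrib) simp
  also have "ennreal \<dots> \<le> ennreal (?\<kappa> * (?t1 + ?t2 + 2 * (?e * ?n))\<^sup>2)"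
    using \<kappa> by (intro ennreal_leI mult_left_mono) (auto simp: power2_sum)
  finally have le: "(\<integral>\<^sup>+z. ennreal ((cmod (indicator ?D z * ?V z))\<^sup>2) \<partial>?M) \<le> ennreal (?\<kappa> * (?t1 + ?t2 + 2 * ?e * ?n)\<^sup>2)"
    by (simp only: mult.assoc)
  have m: "(\<lambda>z. indicator ?D z * ?V z) \<in> borel_measurable ?M"
    using square_integrable_indicator(1)[OF V2 D] by (simp add: square_integrable_def)
  show ?thesis
    by (rule square_integrableI_nn_integral(2)[OF m le]) (use b in auto)
qed

lemma hermite_projection_error:
  assumes u: "square_integrable lborel u" and g: "is_L2_fourier u g" and b: "b > 0" and w: "is_proj u b N w"
    and T: "T \<ge> 0" "b\<^sup>2 * T\<^sup>2 = real N / 8" and S: "S \<ge> 0" "S\<^sup>2 / b\<^sup>2 = real N / 8"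
  shows "l2norm lborel (\<lambda>x. u x - w x) \<le> l2norm lborel (\<lambda>x. indicator {x. \<bar>x\<bar> > T} x * u x)
       + l2norm lborel (\<lambda>k. indicator {k. \<bar>k\<bar> > S} k * g k) + 4 * exp (- (real N / 16)) * l2norm lborel u"
proof -
  let ?M = "(lborel :: real measure) \<Otimes>\<^sub>M (lborel :: real measure)"
  let ?D = "{-2 * T..2 * T} \<times> {-2 * S..2 * S}"
  let ?V = "\<lambda>f z. stft b f (fst z) (snd z)"
  let ?\<kappa> = "2 * pi * (sqrt pi / b)"
  let ?e = "exp (- (real N / 16))"
  define r where "r = (\<lambda>x. u x - w x)"
  have wH: "w \<in> hermite_space b N" and orth: "\<And>v. v \<in> hermite_space b N \<Longrightarrow> L2_inner r v = 0"
    using w by (auto simp: is_proj_def r_def)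
  have w2: "square_integrable lborel w" by (rule hermite_space_square_integrable[OF wH b])
  have r2: "square_integrable lborel r" unfolding r_def by (rule square_integrable_diff(1)[OF u w2])
  have orth': "(\<integral>x. r x * (complex_of_real (exp (- (b\<^sup>2 * x\<^sup>2) / 2)) * complex_of_real x ^ n) \<partial>lborel) = 0" if "n \<le> N" for n
  proof -
    \<comment> \<open>These test functions are real-valued, so the conjugate in
      \<open>L2_inner\<close> disappears and orthogonality is directly the vanishing of the
      moments.\<close>
    let ?v = "\<lambda>x. complex_of_real (exp (- (b\<^sup>2 * x\<^sup>2) / 2)) * poly (monom 1 n) (complex_of_real x)"
    have "?v \<in> hermite_space b N"
      unfolding hermite_space_def using that by (auto simp: degree_monom_eq intro!: exI[of _ "monom 1 n"])
    from orth[OF this] show ?thesis by (simp add: L2_inner_def poly_monom)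
  qed
  note Vr = stft_isometry[OF r2 b] and Vu = stft_isometry[OF u b]
  have \<kappa>: "?\<kappa> > 0" using b by simp
  have D: "?D \<in> sets ?M" by simp
  from sets.compl_sets[OF this] have D': "- ?D \<in> sets ?M"
    by (simp add: space_pair_measure Compl_eq_Diff_UNIV)
  note rD = square_integrable_indicator(1)[OF Vr(1) D] and uD = square_integrable_indicator(1)[OF Vu(1) D']
  have l2: "l2norm ?M f \<le> sqrt ?\<kappa> * c" if "(l2norm ?M f)\<^sup>2 \<le> ?\<kappa> * c\<^sup>2" "c \<ge> 0" for f c
    using real_sqrt_le_mono[OF that(1)] that(2) by (simp only: real_sqrt_mult real_sqrt_abs l2norm_nonneg abs_of_nonneg)
  define t where "t = l2norm lborel (\<lambda>x. indicator {x. \<bar>x\<bar> > T} x * u x)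
       + l2norm lborel (\<lambda>k. indicator {k. \<bar>k\<bar> > S} k * g k)"
  let ?nu = "l2norm lborel u" and ?nr = "l2norm lborel r"
  have t: "t \<ge> 0" by (simp add: t_def)
  have n1: "l2norm ?M (?V u) \<le> sqrt ?\<kappa> * ?nu"
    by (rule l2[OF Vu(2)[THEN eq_refl] l2norm_nonneg])
  have n2: "l2norm ?M (?V r) \<le> sqrt ?\<kappa> * ?nr"
    by (rule l2[OF Vr(2)[THEN eq_refl] l2norm_nonneg])
  have n3: "l2norm ?M (\<lambda>z. indicator ?D z * ?V r z) \<le> sqrt ?\<kappa> * (2 * ?e * ?nr)"
    by (rule l2[OF stft_orthogonal_box[OF r2 b orth' T S]]) simp_all
  have n4: "l2norm ?M (\<lambda>z. indicator (- ?D) z * ?V u z) \<le> sqrt ?\<kappa> * (t + 2 * ?e * ?nu)"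
    by (rule l2[OF stft_outside_box[OF u g b T S, folded t_def]]) (use t in simp)
  have split: "(s * (2 * e * x)) * (s * y) + (s * x) * (s * (t + 2 * e * y)) = s\<^sup>2 * (x * (t + 4 * e * y))" for s e x y :: real
    by (simp add: power2_eq_square algebra_simps)
  have "?\<kappa> * ?nr\<^sup>2 \<le> (\<integral>z. cmod (?V r z) * cmod (?V u z) \<partial>?M)"
    by (rule stft_orthogonal_decomposition[OF r2 w2 _ orth[OF wH] b]) (simp add: r_def)
  \<comment> \<open>The indicator is attached to \<open>r\<close> on the box and to \<open>u\<close>
    off it, in each half to the factor whose smallness there is known.\<close>
  also have "\<dots> = (\<integral>z. cmod (indicator ?D z * ?V r z) * cmod (?V u z) + cmod (?V r z) * cmod (indicator (- ?D) z * ?V u z) \<partial>?M)"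
    by (rule Bochner_Integration.integral_cong) (auto split: split_indicator)
  also have "\<dots> = (\<integral>z. cmod (indicator ?D z * ?V r z) * cmod (?V u z) \<partial>?M) + (\<integral>z. cmod (?V r z) * cmod (indicator (- ?D) z * ?V u z) \<partial>?M)"
    by (rule Bochner_Integration.integral_add[OF Cauchy_Schwarz_integral(1)[OF rD Vu(1)] Cauchy_Schwarz_integral(1)[OF Vr(1) uD]])
  also have "\<dots> \<le> l2norm ?M (\<lambda>z. indicator ?D z * ?V r z) * l2norm ?M (?V u) + l2norm ?M (?V r) * l2norm ?M (\<lambda>z. indicator (- ?D) z * ?V u z)"
    by (rule add_mono[OF Cauchy_Schwarz_integral(2)[OF rD Vu(1)] Cauchy_Schwarz_integral(2)[OF Vr(1) uD]])
  also have "\<dots> \<le> (sqrt ?\<kappa> * (2 * ?e * ?nr)) * (sqrt ?\<kappa> * ?nu) + (sqrt ?\<kappa> * ?nr) * (sqrt ?\<kappa> * (t + 2 * ?e * ?nu))"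
    using \<kappa> by (intro add_mono mult_mono n1 n2 n3 n4 mult_nonneg_nonneg) auto
  also have "\<dots> = (sqrt ?\<kappa>)\<^sup>2 * (?nr * (t + 4 * ?e * ?nu))"
    by (rule split)
  also have "(sqrt ?\<kappa>)\<^sup>2 = ?\<kappa>" using \<kappa> by simp
  \<comment> \<open>Cancelling one factor \<open>?nr\<close> gives the claim, the case
    \<open>?nr = 0\<close> being trivial. The coefficient 4 is 2 from the box plus 2 from leakage
    outside it.\<close>
  finally have "?nr * ?nr \<le> ?nr * (t + 4 * ?e * ?nu)"
    using \<kappa> by (simp only: mult_le_cancel_left_pos power2_eq_square)
  moreover have "0 \<le> t + 4 * ?e * ?nu" using t by simp
  ultimately have "?nr \<le> t + 4 * ?e * ?nu"
    by (cases "?nr = 0") (auto simp: mult_le_cancel_left less_le)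
  then show ?thesis by (simp add: t_def r_def)
qed

theorem theorem2p4:
  shows "\<exists>C>0. \<forall>(u :: real \<Rightarrow> complex) (N :: nat) (\<beta> :: real) g w.
     sq_int u \<longrightarrow> \<beta> > 0 \<longrightarrow> is_L2_fourier u g \<longrightarrow> is_proj u \<beta> N w \<longrightarrow>
     L2_norm (\<lambda>x. u x - w x) \<le>
       C * ( L2_norm (\<lambda>x. indicator {x. \<bar>x\<bar> > (1 / (2 * sqrt 2)) * sqrt (real N) / \<beta>} x * u x)
           + L2_norm (\<lambda>k. indicator {k. \<bar>k\<bar> > (1 / (2 * sqrt 2)) * sqrt (real N) * \<beta>} k * g k)
           + L2_norm u * exp (- (1 / 16) * real N))"
proof (intro exI[of _ 4] conjI allI impI)
  fix u g w :: "real \<Rightarrow> complex" and N :: nat and \<beta> :: real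
  assume u: "sq_int u" and b: "\<beta> > 0" and g: "is_L2_fourier u g" and w: "is_proj u \<beta> N w"
  let ?T = "(1 / (2 * sqrt 2)) * sqrt (real N) / \<beta>" and ?S = "(1 / (2 * sqrt 2)) * sqrt (real N) * \<beta>"
  \<comment> \<open>The square of 1 / (2 sqrt 2) is 1/8; the values of a and b enter the estimates
    only through these two relations.\<close>
  have T: "?T \<ge> 0" "\<beta>\<^sup>2 * ?T\<^sup>2 = real N / 8" and S: "?S \<ge> 0" "?S\<^sup>2 / \<beta>\<^sup>2 = real N / 8"
    using b by (auto simp: power_divide power_mult_distrib)
  have u': "square_integrable lborel u" using u by (simp add: sq_int_eq_square_integrable)
  let ?t1 = "L2_norm (\<lambda>x. indicator {x. \<bar>x\<bar> > ?T} x * u x)"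
  let ?t2 = "L2_norm (\<lambda>k. indicator {k. \<bar>k\<bar> > ?S} k * g k)"
  have "L2_norm (\<lambda>x. u x - w x) \<le> ?t1 + ?t2 + 4 * exp (- (real N / 16)) * L2_norm u"
    unfolding L2_norm_eq_l2norm by (rule hermite_projection_error[OF u' g b w T S])
  \<comment> \<open>Only the exponential term requires the 4; the tails, obtained with coefficient
    1, are enlarged to share it.\<close>
  also have "\<dots> \<le> 4 * ?t1 + 4 * ?t2 + 4 * exp (- (real N / 16)) * L2_norm u"
    by (simp add: L2_norm_eq_l2norm)
  also have "\<dots> = 4 * (?t1 + ?t2 + L2_norm u * exp (- (1 / 16) * real N))" by simp
  finally show "L2_norm (\<lambda>x. u x - w x) \<le> 4 * (?t1 + ?t2 + L2_norm u * exp (- (1 / 16) * real N))" .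
qed simp

end
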